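(* Consider the quasi maximum likelihood estimation problem $$\min_{\beta\in\mathcal M}\ f(\beta)=\mathbb E_{(x,y)\sim\mathsf D}\big[h(\langle x,\beta\rangle)-y\langle x,\beta\rangle\big]$$ for a generalized linear model with cumulant function $h$, parameter $\beta_\star\in\mathcal M$, and permissible set of feature distributions $\mathcal Q\subset\mathcal P_2(\mathbf R^d)$. Let $\mathsf D_x\in\mathcal Q$ be the distribution of $x$, let $\Sigma=\mathbb E[xx^\top]$, and let $\mathcal T$ be the tangent space of $\mathcal M$ at $\beta_\star$. Suppose that for every $\mu\in\mathcal Q$ we have $(\mathsf P_{v^\perp})_\#\mu\in\mathcal Q$ for some eigenvector $v\in\mathcal T$ of $\Sigma_\mu|_{\mathcal T}$ corresponding to its minimal eigenvalue. Then $$\mathrm{RSE}(\mathsf D)=\sqrt{\lambda_{\min}(\Sigma|_{\mathcal T})}.$$ In particular, if $\mathsf D_x\in\mathcal Q\setminus\mathcal E$ and for some $c_{\rm lb},c_{\rm ub}>0$ the inequalities $c_{\rm lb}\le h''(\langle x,\beta_\star\rangle)^{-1}\le c_{\rm ub}$ hold for $\mathsf D_x$-almost every $x$, then $$c_{\rm lb}\le\mathrm{RSE}(\mathsf D)^2\cdot\mathrm{REG}(\mathsf D)\le c_{\rm ub}.$$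
   Context: Setting: $\mathcal M\subset\mathbf R^d$ is a $C^2$-smooth embedded submanifold of positive dimension, $\beta_\star\in\mathcal M$, $h\colon\mathbf R\to\mathbf R$ is a $C^2$-smooth convex function with $h''>0$, $\sigma^2>0$. The conditional law $\mathsf D_{y\mid x}$ of the label is fixed and satisfies the GLM conditions $\mathbb E[y\mid x]=h'(\langle x,\beta_\star\rangle)$ and $\mathrm{Var}[y\mid x]=\sigma^2 h''(\langle x,\beta_\star\rangle)$. $\mathsf D=\mathsf D_x\times\mathsf D_{y\mid x}$ denotes the joint law of $(x,y)$. $\mathcal P_2(\mathbf R^d)$ is the set of Borel probability measures with finite second moment. Blanket assumption on $\mathcal Q\subset\mathcal P_2(\mathbf R^d)$: for every $\mu\in\mathcal Q$, with $x\sim\mu$ and $y\mid x\sim\mathsf D_{y\mid x}$, $y$ is square integrable, the expectations involved exist, the objective $f$ is $C^2$-smooth on $\mathcal M$ (has local $C^2$ extensions), and $\phi(\beta)=\mathbb E[h(\langle x,\beta\rangle)]$ is well defined on $\mathcal M$ and has a $C^2$-smooth local extension to a neighborhood of $\beta_\star$ in $\mathbf R^d$ with $\nabla\phi(\beta_\star)=\mathbb E[h'(\langle x,\beta_\star\rangle)x]$ and $\nabla^2\phi(\beta_\star)=\mathbb E[h''(\langle x,\beta_\star\rangle)xx^\top]$. Notation: $\Sigma_\mu=\mathbb E_\mu[xx^\top]$; for a subspace $\mathcal T$, $A|_{\mathcal T}\colon\mathcal T\to\mathcal T$ is the compression, i.e. the restriction of $\mathsf P_{\mathcal T}A$ to $\mathcal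 T$, with $\mathsf P_{\mathcal T}$ the orthogonal projection; $T_\#\mu$ is the pushforward. $W_2(\mu,\nu)=\min_{\pi\in\Pi(\mu,\nu)}(\mathbb E_{(x,y)\sim\pi}\|x-y\|_2^2)^{1/2}$ over couplings, $W_2(\mu,\mathcal E)=\inf_{\nu\in\mathcal E}W_2(\mu,\nu)$. Tilt-stability and REG: a minimizer $\beta_\star$ of $f$ over $\mathcal M$ is tilt-stable if for some $\varepsilon>0$ the map $\sigma(v)=\operatorname{argmin}_{\beta\in\mathcal M\cap B_\varepsilon(\beta_\star)}\{f(\beta)-\langle v,\beta\rangle\}$ satisfies $\sigma(0)=\beta_\star$ and is single-valued and $C^1$-smooth on a neighborhood of the origin; then $\mathrm{REG}=\|\nabla\sigma(0)\|_{\rm op}$; otherwise $\mathrm{REG}=+\infty$. $\mathrm{REG}(\mathsf D)$ is this quantity for the displayed problem at $\beta_\star$. RSE (supervised): $\mathcal E=\{\mu\in\mathcal Q:\beta_\star\text{ is not a tilt-stable minimizer of the problem with }\mathsf D\text{ replaced by }\mu\times\mathsf D_{y\mid x}\}$ and $\mathrm{RSE}(\mathsf D)=W_2(\mathsf D_x,\mathcal E)$. *)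

theory Defs
  imports "HOL-Probability.Probability"
begin

section \<open>Smooth maps and embedded submanifolds\<close>

text \<open>Both notions are meant for open sets \<open>U\<close>.\<close>

definition C1_on :: "'a::real_normed_vector set \<Rightarrow> ('a \<Rightarrow> 'b::real_normed_vector) \<Rightarrow> bool" where
  "C1_on U f \<longleftrightarrow> (\<exists>f' :: 'a \<Rightarrow> 'a \<Rightarrow>\<^sub>L 'b.
     (\<forall>x\<in>U. (f has_derivative blinfun_apply (f' x)) (at x)) \<and> continuous_on U f')"

definition C2_on :: "'a::real_normed_vector set \<Rightarrow> ('a \<Rightarrow> 'b::real_normed_vector) \<Rightarrow> bool" where
  "C2_on U f \<longleftrightarrow> (\<exists>f' :: 'a \<Rightarrow> 'a \<Rightarrow>\<^sub>L 'b.
     (\<forall>x\<in>U. (f has_derivative blinfun_apply (f' x)) (at x)) \<and> C1_on U f')"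

text \<open>Embedded submanifolds of dimension \<open>k\<close> through the local slice condition: around each of its
  points, \<open>M\<close> is straightened to a relatively open part of a \<open>k\<close>-dimensional linear subspace by a \<open>C\<^sup>2\<close> diffeomorphism
  between open subsets of the ambient space.\<close>

definition C2_submanifold :: "nat \<Rightarrow> 'a::euclidean_space set \<Rightarrow> bool" where
  "C2_submanifold k M \<longleftrightarrow> (\<forall>p\<in>M. \<exists>(U :: 'a set) (V :: 'a set) \<Phi> \<Psi> S.
     open U \<and> p \<in> U \<and> open V \<and> homeomorphism U V \<Phi> \<Psi> \<and> C2_on U \<Phi> \<and> C2_on V \<Psi> \<and>
     subspace S \<and> dim S = k \<and> \<Phi> ` (M \<inter> U) = S \<inter> V)"

text \<open>Velocities at \<open>p\<close> of \<open>C\<^sup>1\<close> curves in \<open>M\<close>.\<close>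

definition tangent_space :: "'a::euclidean_space set \<Rightarrow> 'a \<Rightarrow> 'a set" where
  "tangent_space M p = {v. \<exists>\<epsilon>>0. \<exists>\<gamma> :: real \<Rightarrow> 'a. C1_on {-\<epsilon><..<\<epsilon>} \<gamma> \<and> \<gamma> ` {-\<epsilon><..<\<epsilon>} \<subseteq> M \<and>
     \<gamma> 0 = p \<and> (\<gamma> has_vector_derivative v) (at 0)}"

definition C2_on_manifold :: "'a::euclidean_space set \<Rightarrow> ('a \<Rightarrow> real) \<Rightarrow> bool" where
  "C2_on_manifold M f \<longleftrightarrow>
     (\<forall>p\<in>M. \<exists>U g. open U \<and> p \<in> U \<and> C2_on U g \<and> (\<forall>x\<in>M \<inter> U. g x = f x))"


section \<open>Projections, compressions and minimal eigenvalues\<close>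

definition orth_proj :: "'a::euclidean_space set \<Rightarrow> 'a \<Rightarrow> 'a" where
  "orth_proj T x = (THE y. y \<in> T \<and> (\<forall>z\<in>T. orthogonal (x - y) z))"

text \<open>Only the values of \<open>compression T A\<close> on \<open>T\<close> are relevant.\<close>

definition compression :: "(real^'d) set \<Rightarrow> real^'d^'d \<Rightarrow> real^'d \<Rightarrow> real^'d" where
  "compression T A v = orth_proj T (A *v v)"

definition eigenpair_on :: "'a::real_vector set \<Rightarrow> ('a \<Rightarrow> 'a) \<Rightarrow> real \<Rightarrow> 'a \<Rightarrow> bool" where
  "eigenpair_on T L l v \<longleftrightarrow> v \<in> T \<and> v \<noteq> 0 \<and> L v = l *\<^sub>R v"

definition min_eigenvalue_on :: "'a::real_vector set \<Rightarrow> ('a \<Rightarrow> 'a) \<Rightarrow> real" where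
  "min_eigenvalue_on T L = (LEAST l. \<exists>v. eigenpair_on T L l v)"


section \<open>Feature distributions and the Wasserstein distance\<close>

definition P2 :: "'a::euclidean_space measure set" where
  "P2 = {\<mu>. prob_space \<mu> \<and> sets \<mu> = sets borel \<and> integrable \<mu> (\<lambda>x. (norm x)\<^sup>2)}"

definition outer :: "real^'d \<Rightarrow> real^'d^'d" where
  "outer x = (\<chi> i j. x $ i * x $ j)"

definition second_moment :: "(real^'d) measure \<Rightarrow> real^'d^'d" where
  "second_moment \<mu> = (\<integral>x. outer x \<partial>\<mu>)"

definition couplings :: "'a::euclidean_space measure \<Rightarrow> 'a measure \<Rightarrow> ('a \<times> 'a) measure set" where
  "couplings \<mu> \<nu> = {\<pi>. prob_space \<pi> \<and> sets \<pi> = sets (borel \<Otimes>\<^sub>M borel) \<and>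
     distr \<pi> borel fst = \<mu> \<and> distr \<pi> borel snd = \<nu>}"

text \<open>Meant for \<open>\<mu>\<close> and \<open>\<nu>\<close> in \<open>P2\<close>, where the quadratic cost is integrable against each coupling.
  Values are extended reals so that the distance to the empty set is \<open>\<infinity>\<close>.\<close>

definition W2 :: "'a::euclidean_space measure \<Rightarrow> 'a measure \<Rightarrow> ennreal" where
  "W2 \<mu> \<nu> = (INF \<pi>\<in>couplings \<mu> \<nu>. ennreal (sqrt (\<integral>(x, y). (norm (x - y))\<^sup>2 \<partial>\<pi>)))"

definition W2_set :: "'a::euclidean_space measure \<Rightarrow> 'a measure set \<Rightarrow> ennreal" where
  "W2_set \<mu> E = (INF \<nu>\<in>E. W2 \<mu> \<nu>)"


section \<open>Tilt-stability and the regularity modulus\<close>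

definition is_minimizer :: "'a set \<Rightarrow> ('a \<Rightarrow> real) \<Rightarrow> 'a \<Rightarrow> bool" where
  "is_minimizer M f b \<longleftrightarrow> b \<in> M \<and> (\<forall>\<beta>\<in>M. f b \<le> f \<beta>)"

definition tilt_argmin ::
  "'a::euclidean_space set \<Rightarrow> ('a \<Rightarrow> real) \<Rightarrow> 'a \<Rightarrow> real \<Rightarrow> 'a \<Rightarrow> 'a set" where
  "tilt_argmin M f b \<epsilon> v = {\<beta>. is_minimizer (M \<inter> cball b \<epsilon>) (\<lambda>\<beta>. f \<beta> - v \<bullet> \<beta>) \<beta>}"

definition tilt_solution ::
  "'a::euclidean_space set \<Rightarrow> ('a \<Rightarrow> real) \<Rightarrow> 'a \<Rightarrow> real \<Rightarrow> 'a \<Rightarrow> 'a" where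
  "tilt_solution M f b \<epsilon> v = (THE \<beta>. tilt_argmin M f b \<epsilon> v = {\<beta>})"

definition tilt_stable_radius ::
  "'a::euclidean_space set \<Rightarrow> ('a \<Rightarrow> real) \<Rightarrow> 'a \<Rightarrow> real \<Rightarrow> bool" where
  "tilt_stable_radius M f b \<epsilon> \<longleftrightarrow> \<epsilon> > 0 \<and> tilt_argmin M f b \<epsilon> 0 = {b} \<and>
     (\<exists>V. open V \<and> 0 \<in> V \<and> (\<forall>v\<in>V. \<exists>\<beta>. tilt_argmin M f b \<epsilon> v = {\<beta>}) \<and>
          C1_on V (tilt_solution M f b \<epsilon>))"

definition tilt_stable_minimizer ::
  "'a::euclidean_space set \<Rightarrow> ('a \<Rightarrow> real) \<Rightarrow> 'a \<Rightarrow> bool" where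
  "tilt_stable_minimizer M f b \<longleftrightarrow> is_minimizer M f b \<and> (\<exists>\<epsilon>. tilt_stable_radius M f b \<epsilon>)"

text \<open>For any two admissible radii the solution maps agree near \<open>0\<close>, so the choice of \<open>\<epsilon>\<close> below
  does not affect the value.\<close>

definition REG :: "'a::euclidean_space set \<Rightarrow> ('a \<Rightarrow> real) \<Rightarrow> 'a \<Rightarrow> ennreal" where
  "REG M f b = (if tilt_stable_minimizer M f b
     then ennreal (onorm (frechet_derivative
            (tilt_solution M f b (SOME \<epsilon>. tilt_stable_radius M f b \<epsilon>)) (at 0)))
     else \<infinity>)"


section \<open>Generalized linear models\<close>

text \<open>Joint law of \<open>(x, y)\<close> with \<open>x\<close> distributed by \<open>\<mu>\<close> and \<open>y\<close> given \<open>x\<close> by the kernel \<open>K\<close>.\<close>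

definition joint_law ::
  "'a::euclidean_space measure \<Rightarrow> ('a \<Rightarrow> real measure) \<Rightarrow> ('a \<times> real) measure" where
  "joint_law \<mu> K = bind \<mu> (\<lambda>x. bind (K x) (\<lambda>y. return (borel \<Otimes>\<^sub>M borel) (x, y)))"

definition qmle_objective ::
  "(real \<Rightarrow> real) \<Rightarrow> (real^'d \<Rightarrow> real measure) \<Rightarrow> (real^'d) measure \<Rightarrow> real^'d \<Rightarrow> real" where
  "qmle_objective h K \<mu> \<beta> = (\<integral>(x, y). h (x \<bullet> \<beta>) - y * (x \<bullet> \<beta>) \<partial>(joint_law \<mu> K))"

definition glm_conditions ::
  "(real \<Rightarrow> real) \<Rightarrow> (real \<Rightarrow> real) \<Rightarrow> real \<Rightarrow> real^'d \<Rightarrow> (real^'d \<Rightarrow> real measure) \<Rightarrow>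
    (real^'d) measure \<Rightarrow> bool" where
  "glm_conditions h' h'' \<sigma> b K \<mu> \<longleftrightarrow>
     (AE x in \<mu>. (\<integral>y. y \<partial>K x) = h' (x \<bullet> b) \<and>
                 (\<integral>y. (y - (\<integral>z. z \<partial>K x))\<^sup>2 \<partial>K x) = \<sigma>\<^sup>2 * h'' (x \<bullet> b))"

text \<open>Near \<open>b\<close>, \<open>\<phi>\<close> restricted to \<open>M\<close> extends to a \<open>C\<^sup>2\<close> function
  on an open set of the ambient space, with gradient \<open>G\<^sub>0\<close> and Hessian \<open>H\<close> at \<open>b\<close>.\<close>

definition has_gradient_hessian_ext ::
  "(real^'d) set \<Rightarrow> (real^'d \<Rightarrow> real) \<Rightarrow> real^'d \<Rightarrow> real^'d \<Rightarrow> real^'d^'d \<Rightarrow> bool" where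
  "has_gradient_hessian_ext M \<phi> b G\<^sub>0 H \<longleftrightarrow> (\<exists>U g G.
     open U \<and> b \<in> U \<and> C2_on U g \<and> (\<forall>\<beta>\<in>M \<inter> U. g \<beta> = \<phi> \<beta>) \<and>
     (\<forall>\<beta>\<in>U. GDERIV g \<beta> :> G \<beta>) \<and> G b = G\<^sub>0 \<and> (G has_derivative (\<lambda>v. H *v v)) (at b))"

text \<open>The standing regularity requirements on a permissible feature distribution.\<close>

definition regular_feature_law ::
  "(real^'d) set \<Rightarrow> (real \<Rightarrow> real) \<Rightarrow> (real \<Rightarrow> real) \<Rightarrow> (real \<Rightarrow> real) \<Rightarrow> real^'d \<Rightarrow>
    (real^'d \<Rightarrow> real measure) \<Rightarrow> (real^'d) measure \<Rightarrow> bool" where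
  "regular_feature_law M h h' h'' b K \<mu> \<longleftrightarrow>
     integrable (joint_law \<mu> K) (\<lambda>(x, y). y\<^sup>2) \<and>
     (\<forall>\<beta>\<in>M. integrable (joint_law \<mu> K) (\<lambda>(x, y). h (x \<bullet> \<beta>) - y * (x \<bullet> \<beta>))) \<and>
     (\<forall>\<beta>\<in>M. integrable \<mu> (\<lambda>x. h (x \<bullet> \<beta>))) \<and>
     integrable \<mu> (\<lambda>x. h' (x \<bullet> b) *\<^sub>R x) \<and>
     integrable \<mu> (\<lambda>x. h'' (x \<bullet> b) *\<^sub>R outer x) \<and>
     C2_on_manifold M (qmle_objective h K \<mu>) \<and>
     has_gradient_hessian_ext M (\<lambda>\<beta>. \<integral>x. h (x \<bullet> \<beta>) \<partial>\<mu>) b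
       (\<integral>x. h' (x \<bullet> b) *\<^sub>R x \<partial>\<mu>) (\<integral>x. h'' (x \<bullet> b) *\<^sub>R outer x \<partial>\<mu>)"

definition ill_posed ::
  "(real^'d) set \<Rightarrow> (real \<Rightarrow> real) \<Rightarrow> real^'d \<Rightarrow> (real^'d \<Rightarrow> real measure) \<Rightarrow>
    (real^'d) measure set \<Rightarrow> (real^'d) measure set" where
  "ill_posed M h b K Q = {\<mu> \<in> Q. \<not> tilt_stable_minimizer M (qmle_objective h K \<mu>) b}"

definition RSE ::
  "(real^'d) set \<Rightarrow> (real \<Rightarrow> real) \<Rightarrow> real^'d \<Rightarrow> (real^'d \<Rightarrow> real measure) \<Rightarrow>
    (real^'d) measure set \<Rightarrow> (real^'d) measure \<Rightarrow> ennreal" where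
  "RSE M h b K Q \<mu> = W2_set \<mu> (ill_posed M h b K Q)"

end

theory Submission
  imports Defs
begin

text \<open>Convexity of \<open>h\<close> and the mean condition make \<open>\<beta>\<^sub>\<star>\<close> a global minimizer with vanishing gradient for
  each permissible \<open>\<mu>\<close>, so tilt-stability is decided by the Hessian
  \<open>H = E[h''(\<langle>x, \<beta>\<^sub>\<star>\<rangle>) x x\<^sup>T]\<close> on the tangent space \<open>\<T>\<close>. If \<open>H\<close> is positive definite on \<open>\<T>\<close>, the inverse
  function theorem solves the tilted critical point equation, and a compactness argument
  identifies its solution with the minimizer. Conversely, differentiating the critical point equation
  along the solution map shows that its derivative inverts the compression of \<open>H\<close> to \<open>\<T>\<close>.
  As \<open>h'' > 0\<close>, the law \<open>\<mu>\<close> is ill-posed iff \<open>\<langle>x, w\<rangle> = 0\<close> almost surely for some nonzero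
  \<open>w \<in> \<T>\<close>. Testing the transport cost in the direction \<open>w\<close> bounds the distance to such laws from below by the
  minimal eigenvalue of the compressed second moment, and projecting out a minimal
  eigenvector attains this bound.\<close>

section \<open>Orthogonal projections and \<open>C\<^sup>1\<close> maps\<close>

text \<open>Because the ambient gradient of the objective vanishes at \<open>b\<close>, the
  curvature of \<open>M\<close> never enters: whenever the critical point equation is
  differentiated, each term with a second derivative of the chart carries a factor that is zero at
  the base point, and the plain compression of the Hessian remains. No \<open>k\<close> coordinates
  are introduced; the normal multiplier of a critical point is kept as a further unknown, so that
  the inverse function theorem applies to a map of the ambient space into itself. That theorem gives
  uniqueness of tilted minimizers and compactness their existence; a strict gap on the bounding
  sphere keeps them off the sphere, where the first-order condition could fail. The weight
  \<open>h''\<close> changes the Hessian form but not its null directions. Hence the distance to the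
  ill-posed laws sees only the unweighted second moment, while the modulus sees the weighted one,
  and the two constants measure this discrepancy alone.\<close>

lemma orth_proj_eqI:
  assumes "subspace T" "y \<in> T" "\<And>z. z \<in> T \<Longrightarrow> (x - y) \<bullet> z = 0"
  shows "orth_proj T x = y"
  unfolding orth_proj_def
proof (rule the_equality)
  show "y \<in> T \<and> (\<forall>z\<in>T. orthogonal (x - y) z)"
    using assms by (simp add: orthogonal_def)
  fix y' assume y': "y' \<in> T \<and> (\<forall>z\<in>T. orthogonal (x - y') z)"
  have "y' - y \<in> T"
    using assms y' by (simp add: subspace_diff)
  then have "(x - y) \<bullet> (y' - y) = 0" "(x - y') \<bullet> (y' - y) = 0"
    using assms y' by (auto simp: orthogonal_def)
  then have "(y' - y) \<bullet> (y' - y) = 0"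
    by (simp add: inner_diff_left)
  then show "y' = y" by simp
qed

lemma orth_proj:
  assumes "subspace T"
  shows orth_proj_in: "orth_proj T x \<in> T"
    and orth_proj_orthogonal: "z \<in> T \<Longrightarrow> (x - orth_proj T x) \<bullet> z = 0"
proof -
  obtain y w where y: "y \<in> span T" and w: "\<And>z. z \<in> span T \<Longrightarrow> orthogonal w z" and x: "x = y + w"
    using orthogonal_subspace_decomp_exists by blast
  have "span T = T" using assms by (simp add: span_eq_iff)
  then have "orth_proj T x = y"
    using y w by (intro orth_proj_eqI[OF assms]) (auto simp only: orthogonal_def x add_diff_cancel_left')
  then show "orth_proj T x \<in> T" "z \<in> T \<Longrightarrow> (x - orth_proj T x) \<bullet> z = 0"
    using y w \<open>span T = T\<close> by (auto simp: orthogonal_def x)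
qed

lemma orth_proj_id: "subspace T \<Longrightarrow> x \<in> T \<Longrightarrow> orth_proj T x = x"
  by (rule orth_proj_eqI) auto

lemma bounded_linear_orth_proj:
  fixes T :: "'a::euclidean_space set"
  assumes T: "subspace T"
  shows "bounded_linear (orth_proj T)"
proof -
  have "linear (orth_proj T)"
  proof
    fix x y :: 'a and c :: real
    have "(x + y - (orth_proj T x + orth_proj T y)) \<bullet> z = 0" if "z \<in> T" for z
      using orth_proj_orthogonal[OF T that, of x] orth_proj_orthogonal[OF T that, of y]
      by (simp add: inner_diff_left inner_add_left)
    then show "orth_proj T (x + y) = orth_proj T x + orth_proj T y"
      by (intro orth_proj_eqI) (auto simp: T orth_proj_in subspace_add)
    have "(c *\<^sub>R x - c *\<^sub>R orth_proj T x) \<bullet> z = 0" if "z \<in> T" for z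
      using orth_proj_orthogonal[OF T that, of x] by (simp add: inner_diff_left)
    then show "orth_proj T (c *\<^sub>R x) = c *\<^sub>R orth_proj T x"
      by (intro orth_proj_eqI) (auto simp: T orth_proj_in subspace_scale)
  qed
  then show ?thesis by (rule linear_conv_bounded_linear[THEN iffD1])
qed

lemma orth_proj_orthogonal_comp_singleton:
  fixes v x :: "'a::euclidean_space"
  assumes "v \<noteq> 0"
  shows "orth_proj (orthogonal_comp {v}) x = x - ((x \<bullet> v) / (v \<bullet> v)) *\<^sub>R v"
proof (rule orth_proj_eqI)
  show "subspace (orthogonal_comp {v})"
    by (rule subspace_orthogonal_comp)
  show "x - ((x \<bullet> v) / (v \<bullet> v)) *\<^sub>R v \<in> orthogonal_comp {v}"
    using assms by (simp add: orthogonal_comp_def orthogonal_def inner_diff_right inner_commute)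
  show "(x - (x - ((x \<bullet> v) / (v \<bullet> v)) *\<^sub>R v)) \<bullet> z = 0" if "z \<in> orthogonal_comp {v}" for z
    using that by (simp add: orthogonal_comp_def orthogonal_def)
qed

section \<open>Calculus of C1 maps and the inverse function theorem\<close>

lemma C1_onI:
  fixes f :: "'a::euclidean_space \<Rightarrow> 'b::real_normed_vector"
  assumes f: "\<And>x. x \<in> U \<Longrightarrow> (f has_derivative D x) (at x)"
    and D: "\<And>v. continuous_on U (\<lambda>x. D x v)"
  shows "C1_on U f"
  unfolding C1_on_def
proof (intro exI conjI ballI)
  have eq: "blinfun_apply (Blinfun (D x)) = D x" if "x \<in> U" for x
    using f[OF that] has_derivative_bounded_linear bounded_linear_Blinfun_apply by blast
  then show "(f has_derivative blinfun_apply (Blinfun (D x))) (at x)" if "x \<in> U" for x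
    using that f by simp
  \<comment> \<open>In finite dimension norm continuity of the derivative reduces to continuity at
    each fixed vector, so derivatives can be supplied as plain functions.\<close>
  show "continuous_on U (\<lambda>x. Blinfun (D x))"
    by (rule continuous_on_blinfun_componentwise) (simp add: eq D cong: continuous_on_cong)
qed

lemma C1_onE:
  assumes "C1_on U f"
  obtains f' where "\<And>x. x \<in> U \<Longrightarrow> (f has_derivative blinfun_apply (f' x)) (at x)"
    "continuous_on U f'"
  using assms unfolding C1_on_def by blast

lemma C1_on_imp_continuous_on: "C1_on U f \<Longrightarrow> continuous_on U f"
  by (elim C1_onE) (blast intro: continuous_at_imp_continuous_on has_derivative_continuous)

lemma C1_on_subset: "C1_on U f \<Longrightarrow> V \<subseteq> U \<Longrightarrow> C1_on V f"
  unfolding C1_on_def using continuous_on_subset by blast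

lemma C1_on_cong:
  assumes "open U" "\<And>x. x \<in> U \<Longrightarrow> f x = g x" "C1_on U f"
  shows "C1_on U g"
proof -
  obtain f' where f': "\<And>x. x \<in> U \<Longrightarrow> (f has_derivative blinfun_apply (f' x)) (at x)" "continuous_on U f'"
    using C1_onE[OF assms(3)] by blast
  have "(g has_derivative blinfun_apply (f' x)) (at x)" if "x \<in> U" for x
    by (rule has_derivative_transform_within_open[OF f'(1)[OF that] assms(1) that assms(2)])
  then show ?thesis
    unfolding C1_on_def using f'(2) by blast
qed

lemma C1_on_bounded_linear:
  fixes f :: "'a::euclidean_space \<Rightarrow> 'b::real_normed_vector"
  assumes "bounded_linear f"
  shows "C1_on U f"
  by (rule C1_onI[where D = "\<lambda>_. f"])
    (simp_all add: assms bounded_linear_imp_has_derivative)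

lemma C1_on_const: "C1_on U (\<lambda>_::'a::euclidean_space. c)"
  by (rule C1_onI[where D = "\<lambda>_ _. 0"]) simp_all

lemma C1_on_add:
  fixes f g :: "'a::euclidean_space \<Rightarrow> 'b::real_normed_vector"
  assumes f: "C1_on U f" and g: "C1_on U g"
  shows "C1_on U (\<lambda>x. f x + g x)"
proof -
  obtain f' where f': "\<And>x. x \<in> U \<Longrightarrow> (f has_derivative blinfun_apply (f' x)) (at x)" "continuous_on U f'"
    using C1_onE[OF f] by blast
  obtain g' where g': "\<And>x. x \<in> U \<Longrightarrow> (g has_derivative blinfun_apply (g' x)) (at x)" "continuous_on U g'"
    using C1_onE[OF g] by blast
  show ?thesis
  proof (rule C1_onI[where D = "\<lambda>x v. f' x v + g' x v"])
    show "((\<lambda>x. f x + g x) has_derivative (\<lambda>v. f' x v + g' x v)) (at x)" if "x \<in> U" for x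
      by (rule has_derivative_add[OF f'(1)[OF that] g'(1)[OF that]])
    show "continuous_on U (\<lambda>x. f' x v + g' x v)" for v
      using f'(2) g'(2) by (intro continuous_on_add blinfun.continuous_on continuous_on_const)
  qed
qed

lemma C1_on_compose:
  fixes f :: "'a::euclidean_space \<Rightarrow> 'b::real_normed_vector" and g :: "'b \<Rightarrow> 'c::real_normed_vector"
  assumes f: "C1_on U f" and g: "C1_on W g" and "f ` U \<subseteq> W"
  shows "C1_on U (\<lambda>x. g (f x))"
proof -
  obtain f' where f': "\<And>x. x \<in> U \<Longrightarrow> (f has_derivative blinfun_apply (f' x)) (at x)" "continuous_on U f'"
    using C1_onE[OF f] by blast
  obtain g' where g': "\<And>x. x \<in> W \<Longrightarrow> (g has_derivative blinfun_apply (g' x)) (at x)" "continuous_on W g'"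
    using C1_onE[OF g] by blast
  have "continuous_on U (\<lambda>x. g' (f x))"
    using continuous_on_compose2[OF g'(2) C1_on_imp_continuous_on[OF f] assms(3)] .
  show ?thesis
  proof (rule C1_onI[where D = "\<lambda>x v. g' (f x) (f' x v)"])
    show "((\<lambda>x. g (f x)) has_derivative (\<lambda>v. g' (f x) (f' x v))) (at x)" if "x \<in> U" for x
      by (rule has_derivative_compose[OF f'(1)[OF that] g'(1)]) (use that assms(3) in blast)
    show "continuous_on U (\<lambda>x. g' (f x) (f' x v))" for v
      using f'(2) \<open>continuous_on U (\<lambda>x. g' (f x))\<close>
      by (intro blinfun.continuous_on continuous_on_const)
  qed
qed

lemma C1_on_bilinear:
  fixes f :: "'a::euclidean_space \<Rightarrow> 'b::real_normed_vector" and g :: "'a \<Rightarrow> 'c::real_normed_vector"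
    and prod :: "'b \<Rightarrow> 'c \<Rightarrow> 'e::real_normed_vector"
  assumes "bounded_bilinear prod" and f: "C1_on U f" and g: "C1_on U g"
  shows "C1_on U (\<lambda>x. prod (f x) (g x))"
proof -
  interpret bounded_bilinear prod by fact
  obtain f' where f': "\<And>x. x \<in> U \<Longrightarrow> (f has_derivative blinfun_apply (f' x)) (at x)" "continuous_on U f'"
    using C1_onE[OF f] by blast
  obtain g' where g': "\<And>x. x \<in> U \<Longrightarrow> (g has_derivative blinfun_apply (g' x)) (at x)" "continuous_on U g'"
    using C1_onE[OF g] by blast
  show ?thesis
  proof (rule C1_onI[where D = "\<lambda>x v. prod (f x) (g' x v) + prod (f' x v) (g x)"])
    show "((\<lambda>x. prod (f x) (g x)) has_derivative (\<lambda>v. prod (f x) (g' x v) + prod (f' x v) (g x))) (at x)"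
      if "x \<in> U" for x
      by (rule FDERIV[OF f'(1)[OF that] g'(1)[OF that]])
    show "continuous_on U (\<lambda>x. prod (f x) (g' x v) + prod (f' x v) (g x))" for v
      using f'(2) g'(2) f[THEN C1_on_imp_continuous_on] g[THEN C1_on_imp_continuous_on]
      by (intro continuous_on continuous_on_add blinfun.continuous_on continuous_on_const)
  qed
qed

text \<open>Rests on the identity
  \<open>B y - B z = B y o\<^sub>L (A z - A y) o\<^sub>L B z\<close>. The resulting bound still
  contains \<open>norm (B y)\<close>; near \<open>z\<close> this factor is absorbed, and
  \<open>d y\<close> alone controls the difference.\<close>

lemma continuous_on_inverse_blinfun:
  fixes A B :: "'t::metric_space \<Rightarrow> 'a::euclidean_space \<Rightarrow>\<^sub>L 'a"
  assumes A: "continuous_on W A" and AB: "\<And>y. y \<in> W \<Longrightarrow> A y o\<^sub>L B y = id_blinfun"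
    and BA: "\<And>y. y \<in> W \<Longrightarrow> B y o\<^sub>L A y = id_blinfun"
  shows "continuous_on W B"
  unfolding continuous_on_def
proof
  fix z assume z: "z \<in> W"
  have AB': "A y (B y v) = v" and BA': "B y (A y v) = v" if "y \<in> W" for y v
    using AB[OF that] BA[OF that] by (metis blinfun_apply_blinfun_compose blinfun_apply_id_blinfun)+
  have lim: "(A \<longlongrightarrow> A z) (at z within W)"
    using A z by (auto simp: continuous_on_def)
  define d where "d = (\<lambda>y. norm (A z - A y))"
  have d0: "(d \<longlongrightarrow> 0) (at z within W)"
    unfolding d_def using tendsto_norm[OF tendsto_diff[OF tendsto_const[of "A z"] lim]] by simp
  have key: "norm (B y - B z) \<le> norm (B y) * d y * norm (B z)" if y: "y \<in> W" for y
  proof -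
    have "B y - B z = B y o\<^sub>L (A z - A y) o\<^sub>L B z"
      by (rule blinfun_eqI)
        (simp add: blinfun.diff_left blinfun.diff_right AB'[OF z] BA'[OF y])
    then show ?thesis
      unfolding d_def
      by (metis (no_types, lifting) norm_blinfun_compose mult_right_mono norm_ge_zero order_trans)
  qed
  \<comment> \<open>The threshold 1/2 is what permits absorbing \<open>norm (B y)\<close> below,
    giving \<open>norm (B y) \<le> 2 * norm (B z)\<close>.\<close>
  have "\<forall>\<^sub>F y in at z within W. d y * norm (B z) < 1/2"
    using tendsto_mult_left_zero[OF d0, of "norm (B z)"] by (rule order_tendstoD) simp
  then have "\<forall>\<^sub>F y in at z within W. norm (B y - B z) \<le> (2 * norm (B z)) * (d y * norm (B z))"
  proof (rule eventually_mp[rotated])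
    show "\<forall>\<^sub>F y in at z within W. d y * norm (B z) < 1/2 \<longrightarrow>
        norm (B y - B z) \<le> (2 * norm (B z)) * (d y * norm (B z))"
      unfolding eventually_at_filter
    proof (intro always_eventually allI impI)
      fix y assume y: "y \<in> W" and s: "d y * norm (B z) < 1/2"
      have "norm (B y) \<le> norm (B z) + norm (B y - B z)"
        by (metis norm_triangle_sub add.commute)
      also have "\<dots> \<le> norm (B z) + norm (B y) * (d y * norm (B z))"
        using key[OF y] by (simp add: mult.assoc)
      also have "\<dots> \<le> norm (B z) + norm (B y) * (1/2)"
        using s by (intro add_left_mono mult_left_mono) auto
      finally have "norm (B y) \<le> 2 * norm (B z)" by simp
      then have "norm (B y) * (d y * norm (B z)) \<le> 2 * norm (B z) * (d y * norm (B z))"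
        by (intro mult_right_mono) (auto simp: d_def)
      then show "norm (B y - B z) \<le> 2 * norm (B z) * (d y * norm (B z))"
        using key[OF y] by (simp add: mult.assoc)
    qed
  qed
  moreover have "((\<lambda>y. (2 * norm (B z)) * (d y * norm (B z))) \<longlongrightarrow> 0) (at z within W)"
    by (rule tendsto_mult_right_zero[OF tendsto_mult_left_zero[OF d0]])
  ultimately have "((\<lambda>y. B y - B z) \<longlongrightarrow> 0) (at z within W)"
    by (rule Lim_null_comparison)
  then show "(B \<longlongrightarrow> B z) (at z within W)"
    using Lim_null by blast
qed

text \<open>The derivative of the local inverse is, point by point, the inverse of the derivative of
  \<open>f\<close>; its norm continuity is \<open>continuous_on_inverse_blinfun\<close>.
  Nondegeneracy is stated as a trivial kernel because that is what positivity of a Hessian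
  delivers.\<close>

lemma C1_inverse_function:
  fixes f :: "'a::euclidean_space \<Rightarrow> 'a"
  assumes U: "open U" and f: "C1_on U f" and x0: "x0 \<in> U"
    and D: "(f has_derivative D) (at x0)" and inj: "\<And>v. D v = 0 \<Longrightarrow> v = 0"
  obtains U' V g where "open U'" "U' \<subseteq> U" "x0 \<in> U'" "open V" "f x0 \<in> V"
    "homeomorphism U' V f g" "C1_on V g"
proof -
  obtain f' where f': "\<And>x. x \<in> U \<Longrightarrow> (f has_derivative blinfun_apply (f' x)) (at x)"
    "continuous_on U f'"
    using C1_onE[OF f] by blast
  have Deq: "D = blinfun_apply (f' x0)"
    using f'(1)[OF x0] D has_derivative_unique by blast
  have linD: "linear D" using D has_derivative_linear by blast
  have "inj D" using linD inj by (simp add: linear_injective_0)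
  then obtain E where E: "linear E" "E \<circ> D = id"
    using linear_injective_left_inverse[OF linD] by blast
  have "blinfun_apply (Blinfun E) = E"
    using E(1) bounded_linear_Blinfun_apply linear_conv_bounded_linear by blast
  then have inv: "Blinfun E o\<^sub>L f' x0 = id_blinfun"
    using E(2) by (intro blinfun_eqI) (simp add: Deq fun_eq_iff)
  obtain U' V g g' where IFT: "open U'" "U' \<subseteq> U" "x0 \<in> U'" "open V" "f x0 \<in> V"
    "homeomorphism U' V f g"
    "\<And>y. y \<in> V \<Longrightarrow> (g has_derivative (g' y)) (at y)"
    "\<And>y. y \<in> V \<Longrightarrow> g' y = inv (blinfun_apply (f' (g y)))"
    "\<And>y. y \<in> V \<Longrightarrow> bij (blinfun_apply (f' (g y)))"
    using inverse_function_theorem[OF U f' x0 inv] by blast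
  have g'apply: "blinfun_apply (Blinfun (g' y)) = g' y" if "y \<in> V" for y
    using IFT(7)[OF that] has_derivative_bounded_linear bounded_linear_Blinfun_apply by blast
  have g'inv: "blinfun_apply (Blinfun (g' y)) = inv (blinfun_apply (f' (g y)))" if "y \<in> V" for y
    using g'apply[OF that] IFT(8)[OF that] by simp
  have "continuous_on V (\<lambda>y. Blinfun (g' y))"
  proof (rule continuous_on_inverse_blinfun)
    show "continuous_on V (\<lambda>y. f' (g y))"
      by (rule continuous_on_compose2[OF f'(2)])
        (use IFT(2,6) in \<open>auto simp: homeomorphism_def\<close>)
    show "f' (g y) o\<^sub>L Blinfun (g' y) = id_blinfun" if "y \<in> V" for y
      using that by (intro blinfun_eqI)
        (simp add: g'inv bij_is_surj[OF IFT(9)] surj_f_inv_f)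
    show "Blinfun (g' y) o\<^sub>L f' (g y) = id_blinfun" if "y \<in> V" for y
      using that by (intro blinfun_eqI)
        (simp add: g'inv bij_is_inj[OF IFT(9)] inv_f_f)
  qed
  then have "C1_on V g"
    unfolding C1_on_def using IFT(7) g'apply by (intro exI[of _ "\<lambda>y. Blinfun (g' y)"]) auto
  with IFT show ?thesis using that by blast
qed

section \<open>Tilted problems in a slice chart\<close>

text \<open>The adjoint of \<open>A\<close> applied to \<open>n\<close>, written in an orthonormal
  basis. With real target and \<open>n = 1\<close> it turns a derivative into a gradient; for the
  chart derivatives it carries normals of \<open>S\<close> to normals of \<open>M\<close> and
  back.\<close>

definition blinfun_adjoint :: "('a::euclidean_space \<Rightarrow>\<^sub>L 'b::real_inner) \<Rightarrow> 'b \<Rightarrow> 'a" where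
  "blinfun_adjoint A n = (\<Sum>i\<in>Basis. (A i \<bullet> n) *\<^sub>R i)"

lemma blinfun_adjoint_inner: "blinfun_adjoint A n \<bullet> w = A w \<bullet> n"
proof -
  have "A w \<bullet> n = A (\<Sum>i\<in>Basis. (w \<bullet> i) *\<^sub>R i) \<bullet> n"
    by (simp add: euclidean_representation)
  also have "\<dots> = (\<Sum>i\<in>Basis. (w \<bullet> i) * (A i \<bullet> n))"
    by (simp add: blinfun.sum_right blinfun.scaleR_right inner_sum_left)
  finally show ?thesis
    by (simp add: blinfun_adjoint_def inner_sum_left inner_commute[of w] mult.commute)
qed

lemma blinfun_adjoint_zero_right [simp]: "blinfun_adjoint A 0 = 0"
  by (simp add: blinfun_adjoint_def)

text \<open>Gives access to the product rule when operator and vector both depend on the base point.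
  The norm bound comes from pairing the adjoint with itself.\<close>

lemma bounded_bilinear_blinfun_adjoint:
  "bounded_bilinear (blinfun_adjoint :: ('a::euclidean_space \<Rightarrow>\<^sub>L 'b::real_inner) \<Rightarrow> 'b \<Rightarrow> 'a)"
proof
  fix A A' :: "'a \<Rightarrow>\<^sub>L 'b" and n n' :: 'b and r :: real
  show "blinfun_adjoint (A + A') n = blinfun_adjoint A n + blinfun_adjoint A' n"
    by (simp add: blinfun_adjoint_def blinfun.add_left inner_add_left scaleR_add_left sum.distrib)
  show "blinfun_adjoint A (n + n') = blinfun_adjoint A n + blinfun_adjoint A n'"
    by (simp add: blinfun_adjoint_def inner_add_right scaleR_add_left sum.distrib)
  show "blinfun_adjoint (r *\<^sub>R A) n = r *\<^sub>R blinfun_adjoint A n"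
    by (simp add: blinfun_adjoint_def blinfun.scaleR_left scaleR_sum_right)
  show "blinfun_adjoint A (r *\<^sub>R n) = r *\<^sub>R blinfun_adjoint A n"
    by (simp add: blinfun_adjoint_def scaleR_sum_right)
  show "\<exists>K. \<forall>(A :: 'a \<Rightarrow>\<^sub>L 'b) n. norm (blinfun_adjoint A n) \<le> norm A * norm n * K"
  proof (intro exI[of _ 1] allI)
    fix A :: "'a \<Rightarrow>\<^sub>L 'b" and n :: 'b
    let ?y = "blinfun_adjoint A n"
    have "norm ?y * norm ?y = A ?y \<bullet> n"
      by (metis blinfun_adjoint_inner power2_norm_eq_inner power2_eq_square)
    also have "\<dots> \<le> norm (A ?y) * norm n"
      by (rule norm_cauchy_schwarz)
    also have "\<dots> \<le> (norm A * norm ?y) * norm n"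
      by (intro mult_right_mono norm_blinfun) simp
    finally have "norm ?y * norm ?y \<le> (norm A * norm n) * norm ?y"
      by (simp add: mult_ac)
    then show "norm ?y \<le> norm A * norm n * 1"
      by (cases "norm ?y = 0") auto
  qed
qed

text \<open>\<open>C2_on\<close> speaks of an operator-valued derivative, the gradient is a
  separately given vector field; uniqueness of derivatives identifies the field with an adjoint and
  transfers the smoothness.\<close>

lemma C1_on_gradient:
  fixes g :: "'a::euclidean_space \<Rightarrow> real"
  assumes U: "open U" and C2: "C2_on U g" and G: "\<And>x. x \<in> U \<Longrightarrow> GDERIV g x :> G x"
  shows "C1_on U G"
proof -
  obtain g' :: "'a \<Rightarrow> 'a \<Rightarrow>\<^sub>L real"
    where g': "\<And>x. x \<in> U \<Longrightarrow> (g has_derivative blinfun_apply (g' x)) (at x)" "C1_on U g'"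
    using C2 unfolding C2_on_def by blast
  have "C1_on U (\<lambda>x. blinfun_adjoint (g' x) 1)"
    by (intro C1_on_bilinear[OF bounded_bilinear_blinfun_adjoint] g'(2) C1_on_const)
  moreover have "blinfun_adjoint (g' x) 1 = G x" if "x \<in> U" for x
  proof -
    have "blinfun_apply (g' x) = (\<lambda>v. v \<bullet> G x)"
      using g'(1)[OF that] G[OF that] has_derivative_unique unfolding gderiv_def by blast
    then have "blinfun_adjoint (g' x) 1 \<bullet> v = G x \<bullet> v" for v
      by (simp add: blinfun_adjoint_inner inner_commute[of v])
    then show ?thesis
      by (metis vector_eq_rdot)
  qed
  ultimately show ?thesis
    by (rule C1_on_cong[OF U, rotated])
qed

section \<open>Slice charts, tangent vectors and first-order conditions\<close>

lemma has_derivative_tendsto_nhds: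
  assumes "(c has_derivative L) (at t)" "c t = p"
  shows "(c \<longlongrightarrow> p) (nhds t)"
  using has_derivative_continuous[OF assms(1)] assms(2) tendsto_at_iff_tendsto_nhds[of c t]
  by (simp add: isCont_def)

text \<open>\<open>g\<close> extends \<open>f\<close> off \<open>M\<close> near \<open>b\<close>
  with gradient field \<open>G\<close>, and \<open>G b = 0\<close> is criticality in the whole
  ambient space. The chart derivatives are fixed as data since they are differentiated once more.
  Minimality and the Hessian enter only in the lemmas that use them.\<close>

locale tilted_chart =
  fixes M U V S :: "'a::euclidean_space set" and b :: 'a
    and \<Phi> \<Psi> G :: "'a \<Rightarrow> 'a" and \<Phi>' \<Psi>' :: "'a \<Rightarrow> 'a \<Rightarrow>\<^sub>L 'a" and f g :: "'a \<Rightarrow> real"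
  assumes open_U: "open U" and open_V: "open V" and b_M: "b \<in> M" and b_U: "b \<in> U"
    and homeo: "homeomorphism U V \<Phi> \<Psi>"
    and \<Phi>': "\<And>x. x \<in> U \<Longrightarrow> (\<Phi> has_derivative blinfun_apply (\<Phi>' x)) (at x)"
    and \<Phi>'_C1: "C1_on U \<Phi>'"
    and \<Psi>': "\<And>x. x \<in> V \<Longrightarrow> (\<Psi> has_derivative blinfun_apply (\<Psi>' x)) (at x)"
    and \<Psi>'_C1: "C1_on V \<Psi>'"
    and S: "subspace S" and slice: "\<Phi> ` (M \<inter> U) = S \<inter> V"
    and ext: "\<And>\<beta>. \<beta> \<in> M \<inter> U \<Longrightarrow> g \<beta> = f \<beta>"
    and grad: "\<And>\<beta>. \<beta> \<in> U \<Longrightarrow> GDERIV g \<beta> :> G \<beta>"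
    and G_C1: "C1_on U G" and G_b: "G b = 0"
begin

lemma
  shows \<Psi>\<Phi>: "\<beta> \<in> U \<Longrightarrow> \<Psi> (\<Phi> \<beta>) = \<beta>" and \<Phi>\<Psi>: "u \<in> V \<Longrightarrow> \<Phi> (\<Psi> u) = u"
    and \<Phi>_V: "\<beta> \<in> U \<Longrightarrow> \<Phi> \<beta> \<in> V" and \<Psi>_U: "u \<in> V \<Longrightarrow> \<Psi> u \<in> U"
  using homeo unfolding homeomorphism_def by auto

lemma C1_\<Psi>: "C1_on V \<Psi>"
  unfolding C1_on_def using \<Psi>' C1_on_imp_continuous_on[OF \<Psi>'_C1] by blast

lemma \<Phi>_S: "\<beta> \<in> M \<Longrightarrow> \<beta> \<in> U \<Longrightarrow> \<Phi> \<beta> \<in> S"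
  using slice by blast

lemma \<Psi>_M: "u \<in> S \<Longrightarrow> u \<in> V \<Longrightarrow> \<Psi> u \<in> M"
  using slice \<Psi>\<Phi> by (metis IntD1 IntD2 IntI imageE)

lemma \<Psi>'\<Phi>':
  assumes "\<beta> \<in> U"
  shows "\<Psi>' (\<Phi> \<beta>) (\<Phi>' \<beta> x) = x"
proof -
  have "((\<lambda>x. \<Psi> (\<Phi> x)) has_derivative (\<lambda>x. \<Psi>' (\<Phi> \<beta>) (\<Phi>' \<beta> x))) (at \<beta>)"
    by (rule has_derivative_compose[OF \<Phi>'[OF assms] \<Psi>'[OF \<Phi>_V[OF assms]]])
  then have "((\<lambda>x. x) has_derivative (\<lambda>x. \<Psi>' (\<Phi> \<beta>) (\<Phi>' \<beta> x))) (at \<beta>)"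
    by (rule has_derivative_transform_within_open[OF _ open_U assms \<Psi>\<Phi>])
  then show ?thesis
    using has_derivative_unique[OF has_derivative_ident] by metis
qed

lemma \<Phi>'\<Psi>':
  assumes "\<beta> \<in> U"
  shows "\<Phi>' \<beta> (\<Psi>' (\<Phi> \<beta>) x) = x"
proof -
  have 1: "(\<Phi> has_derivative blinfun_apply (\<Phi>' \<beta>)) (at (\<Psi> (\<Phi> \<beta>)))"
    using \<Phi>'[OF assms] \<Psi>\<Phi>[OF assms] by simp
  have "((\<lambda>x. \<Phi> (\<Psi> x)) has_derivative (\<lambda>x. \<Phi>' \<beta> (\<Psi>' (\<Phi> \<beta>) x))) (at (\<Phi> \<beta>))"
    by (rule has_derivative_compose[OF \<Psi>'[OF \<Phi>_V[OF assms]] 1])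
  then have "((\<lambda>x. x) has_derivative (\<lambda>x. \<Phi>' \<beta> (\<Psi>' (\<Phi> \<beta>) x))) (at (\<Phi> \<beta>))"
    by (rule has_derivative_transform_within_open[OF _ open_V \<Phi>_V[OF assms] \<Phi>\<Psi>])
  then show ?thesis
    using has_derivative_unique[OF has_derivative_ident] by metis
qed

text \<open>Membership in a linear subspace survives differentiation: the component orthogonal to
  \<open>S\<close> vanishes identically, hence so does its derivative.\<close>

lemma derivative_tangent:
  fixes c :: "'c::real_normed_vector \<Rightarrow> 'a"
  assumes c: "(c has_derivative L) (at t)" and "\<forall>\<^sub>F s in nhds t. c s \<in> M" and t: "c t = b"
  shows "\<Phi>' b (L z) \<in> S"
proof -
  let ?q = "\<lambda>x. x - orth_proj S x"
  have bl: "bounded_linear ?q"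
    by (intro bounded_linear_sub bounded_linear_ident bounded_linear_orth_proj S)
  have c': "(\<Phi> has_derivative blinfun_apply (\<Phi>' b)) (at (c t))"
    using \<Phi>'[OF b_U] t by simp
  have 1: "((\<lambda>s. ?q (\<Phi> (c s))) has_derivative (\<lambda>z. ?q (\<Phi>' b (L z)))) (at t)"
    by (rule bounded_linear.has_derivative[OF bl has_derivative_compose[OF c c']])
  have "\<forall>\<^sub>F s in nhds t. c s \<in> U"
    using topological_tendstoD[OF has_derivative_tendsto_nhds[OF c t] open_U b_U] .
  then have "\<forall>\<^sub>F s in nhds t. 0 = ?q (\<Phi> (c s))"
    using assms(2) by eventually_elim (simp add: orth_proj_id[OF S \<Phi>_S])
  then obtain N where N: "open N" "t \<in> N" "\<And>s. s \<in> N \<Longrightarrow> 0 = ?q (\<Phi> (c s))"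
    unfolding eventually_nhds by blast
  have "((\<lambda>s. ?q (\<Phi> (c s))) has_derivative (\<lambda>z. 0)) (at t)"
    by (rule has_derivative_transform_within_open[OF has_derivative_const N])
  then have "?q (\<Phi>' b (L z)) = 0"
    using has_derivative_unique[OF 1] by metis
  then show ?thesis
    using orth_proj_in[OF S] by (metis eq_iff_diff_eq_0)
qed

text \<open>Turns velocities of curves into a linear condition, from which the subspace property is
  immediate. A vector satisfying it is the velocity of the curve that the chart shows as the line
  through \<open>\<Phi> b\<close> in direction \<open>\<Phi>' b w\<close>.\<close>

lemma tangent_space_eq: "tangent_space M b = {w. \<Phi>' b w \<in> S}"
proof (intro Set.set_eqI iffI)
  fix w assume "w \<in> tangent_space M b"
  then obtain e c where e: "e > 0" "c ` {-e<..<e} \<subseteq> M" "c 0 = b"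
    "(c has_vector_derivative w) (at (0::real))"
    unfolding tangent_space_def by blast
  have "\<forall>\<^sub>F s in nhds 0. s \<in> {-e<..<e}"
    using e(1) by (intro eventually_nhds_in_open) auto
  then have "\<forall>\<^sub>F s in nhds 0. c s \<in> M"
    by eventually_elim (use e(2) in auto)
  then show "w \<in> {w. \<Phi>' b w \<in> S}"
    using derivative_tangent[of c "\<lambda>z. z *\<^sub>R w" 0 1] e by (simp add: has_vector_derivative_def)
next
  fix w assume w: "w \<in> {w. \<Phi>' b w \<in> S}"
  define l where "l = (\<lambda>t::real. \<Phi> b + t *\<^sub>R \<Phi>' b w)"
  have l: "(l has_derivative (\<lambda>t. t *\<^sub>R \<Phi>' b w)) (at t)" for t
    unfolding l_def by (auto intro!: derivative_eq_intros)
  have lC1: "C1_on X l" for X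
    by (rule C1_onI[OF l]) simp
  have l_S: "l t \<in> S" for t
    using w \<Phi>_S[OF b_M b_U] S by (auto simp: l_def subspace_add subspace_scale)
  have "\<forall>\<^sub>F t in nhds 0. l t \<in> V"
    by (rule topological_tendstoD[OF has_derivative_tendsto_nhds[OF l] open_V \<Phi>_V[OF b_U]])
      (simp add: l_def)
  then obtain e where e: "e > 0" "\<And>t. dist t 0 < e \<Longrightarrow> l t \<in> V"
    unfolding eventually_nhds_metric by blast
  have lV: "l ` {-e<..<e} \<subseteq> V"
    using e(2) by (auto simp: dist_real_def)
  have "C1_on {-e<..<e} (\<lambda>t. \<Psi> (l t))"
    by (rule C1_on_compose[OF lC1 C1_\<Psi> lV])
  moreover have "(\<lambda>t. \<Psi> (l t)) ` {-e<..<e} \<subseteq> M"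
    using lV l_S \<Psi>_M by auto
  moreover have "\<Psi> (l 0) = b"
    by (simp add: l_def \<Psi>\<Phi> b_U)
  moreover have "((\<lambda>t. \<Psi> (l t)) has_vector_derivative w) (at 0)"
  proof -
    have "(\<Psi> has_derivative blinfun_apply (\<Psi>' (\<Phi> b))) (at (l 0))"
      using \<Psi>'[OF \<Phi>_V[OF b_U]] by (simp add: l_def)
    from has_derivative_compose[OF l this] show ?thesis
      unfolding has_vector_derivative_def by (simp add: blinfun.scaleR_right \<Psi>'\<Phi>' b_U)
  qed
  ultimately show "w \<in> tangent_space M b"
    unfolding tangent_space_def using e(1) by blast
qed

lemma subspace_tangent_space: "subspace (tangent_space M b)"
  unfolding tangent_space_eq subspace_def
  using S by (auto simp: blinfun.add_right blinfun.scaleR_right subspace_def blinfun.zero_right)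

lemma \<Psi>'_tangent: "s \<in> S \<Longrightarrow> \<Psi>' (\<Phi> b) s \<in> tangent_space M b"
  by (simp add: tangent_space_eq \<Phi>'\<Psi>' b_U)

text \<open>A line through \<open>\<Phi> \<beta>\<close> in a direction of \<open>S\<close> stays in
  \<open>S\<close> and, for small parameters, in \<open>V\<close>. Its image under
  \<open>\<Psi>\<close> is a curve in \<open>M\<close> along which the tilted objective has a local
  minimum, so Fermat's rule in one variable applies.\<close>

lemma tilted_critical:
  assumes \<beta>: "\<beta> \<in> M" "\<beta> \<in> U" and d: "d > 0"
    and min: "\<And>\<beta>'. \<beta>' \<in> M \<Longrightarrow> dist \<beta>' \<beta> < d \<Longrightarrow> f \<beta> - v \<bullet> \<beta> \<le> f \<beta>' - v \<bullet> \<beta>'"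
    and s: "s \<in> S"
  shows "(G \<beta> - v) \<bullet> \<Psi>' (\<Phi> \<beta>) s = 0"
proof -
  define c where "c = (\<lambda>t::real. \<Psi> (\<Phi> \<beta> + t *\<^sub>R s))"
  define q where "q = (\<lambda>t. g (c t) - v \<bullet> c t)"
  have c0: "c 0 = \<beta>" by (simp add: c_def \<Psi>\<Phi> \<beta>)
  have l: "((\<lambda>t::real. \<Phi> \<beta> + t *\<^sub>R s) has_derivative (\<lambda>t. t *\<^sub>R s)) (at 0)"
    by (auto intro!: derivative_eq_intros)
  have "(\<Psi> has_derivative blinfun_apply (\<Psi>' (\<Phi> \<beta>))) (at (\<Phi> \<beta> + (0::real) *\<^sub>R s))"
    using \<Psi>'[OF \<Phi>_V[OF \<beta>(2)]] by simp
  from has_derivative_compose[OF l this]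
  have c': "(c has_derivative (\<lambda>t. t *\<^sub>R \<Psi>' (\<Phi> \<beta>) s)) (at 0)"
    unfolding c_def by (simp add: blinfun.scaleR_right)
  have "(g has_derivative (\<lambda>h. h \<bullet> G \<beta>)) (at (c 0))"
    using grad[OF \<beta>(2)] by (simp add: gderiv_def c0)
  from has_derivative_diff[OF has_derivative_compose[OF c' this]
      has_derivative_inner_right[OF c', of v]]
  have "(q has_derivative (\<lambda>t. t * ((G \<beta> - v) \<bullet> \<Psi>' (\<Phi> \<beta>) s))) (at 0)"
    unfolding q_def by (simp add: inner_diff_left algebra_simps inner_commute)
  then have q': "(q has_real_derivative (G \<beta> - v) \<bullet> \<Psi>' (\<Phi> \<beta>) s) (at 0)"
    by (simp add: has_field_derivative_def mult_commute_abs)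
  have 1: "\<forall>\<^sub>F t in nhds 0. dist (c t) \<beta> < d"
    by (rule tendstoD[OF has_derivative_tendsto_nhds[OF c' c0] d])
  have 2: "\<forall>\<^sub>F t::real in nhds 0. \<Phi> \<beta> + t *\<^sub>R s \<in> V"
    by (rule topological_tendstoD[OF has_derivative_tendsto_nhds[OF l] open_V \<Phi>_V[OF \<beta>(2)]]) simp
  have "\<forall>\<^sub>F t in nhds 0. q 0 \<le> q t"
    using 1 2
  proof eventually_elim
    case (elim t)
    have "\<Phi> \<beta> + t *\<^sub>R s \<in> S"
      using \<Phi>_S[OF \<beta>] S s by (simp add: subspace_add subspace_scale)
    then have "c t \<in> M" "c t \<in> U"
      using elim(2) \<Psi>_M \<Psi>_U by (auto simp: c_def)
    then show ?case
      using min[of "c t"] elim(1) ext \<beta> by (simp add: q_def c0)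
  qed
  then obtain e where "e > 0" "\<And>t. dist t 0 < e \<Longrightarrow> q 0 \<le> q t"
    unfolding eventually_nhds_metric by blast
  then show ?thesis
    using DERIV_local_min[OF q', of e] by (simp add: dist_real_def)
qed

lemma tilt_stable_derivative:
  assumes tilt: "tilt_stable_radius M f b \<epsilon>" and H: "(G has_derivative H) (at b)"
  obtains L where "(tilt_solution M f b \<epsilon> has_derivative L) (at 0)"
    "\<And>z. L z \<in> tangent_space M b"
    "\<And>z w. w \<in> tangent_space M b \<Longrightarrow> H (L z) \<bullet> w = z \<bullet> w"
proof -
  let ?\<sigma> = "tilt_solution M f b \<epsilon>"
  obtain V0 where eps: "\<epsilon> > 0" and arg0: "tilt_argmin M f b \<epsilon> 0 = {b}"
    and V0: "open V0" "0 \<in> V0" "\<And>v. v \<in> V0 \<Longrightarrow> \<exists>\<beta>. tilt_argmin M f b \<epsilon> v = {\<beta>}"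
    "C1_on V0 ?\<sigma>"
    using tilt unfolding tilt_stable_radius_def by blast
  have \<sigma>: "?\<sigma> v \<in> tilt_argmin M f b \<epsilon> v" if "v \<in> V0" for v
    using V0(3)[OF that] by (auto simp: tilt_solution_def)
  have \<sigma>0: "?\<sigma> 0 = b"
    using arg0 by (simp add: tilt_solution_def)
  obtain L where L: "(?\<sigma> has_derivative L) (at 0)"
    using C1_onE[OF V0(4)] V0(2) by blast
  have lim: "(?\<sigma> \<longlongrightarrow> b) (nhds 0)"
    by (rule has_derivative_tendsto_nhds[OF L \<sigma>0])
  \<comment> \<open>Strictly inside the ball the constraint \<open>cball b \<epsilon>\<close> is
    inactive, so the solution is a local minimizer on \<open>M\<close>, as
    \<open>tilted_critical\<close> requires.\<close>
  have near: "\<forall>\<^sub>F v in nhds 0. v \<in> V0 \<and> ?\<sigma> v \<in> U \<and> dist (?\<sigma> v) b < \<epsilon>"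
    by (intro eventually_conj eventually_nhds_in_open V0 topological_tendstoD[OF lim open_U b_U]
        tendstoD[OF lim eps])
  have \<sigma>_M: "?\<sigma> v \<in> M" if "v \<in> V0" for v
    using \<sigma>[OF that] by (simp add: tilt_argmin_def is_minimizer_def)
  have L_T: "L z \<in> tangent_space M b" for z
  proof -
    have "\<forall>\<^sub>F v in nhds 0. ?\<sigma> v \<in> M"
      using near by eventually_elim (simp add: \<sigma>_M)
    from derivative_tangent[OF L this \<sigma>0] show ?thesis
      by (simp add: tangent_space_eq)
  qed
  have crit: "\<forall>\<^sub>F v in nhds 0. 0 = (G (?\<sigma> v) - v) \<bullet> \<Psi>' (\<Phi> (?\<sigma> v)) s" if s: "s \<in> S" for s
    using near
  proof eventually_elim
    case (elim v)
    have "(G (?\<sigma> v) - v) \<bullet> \<Psi>' (\<Phi> (?\<sigma> v)) s = 0"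
    proof (rule tilted_critical[OF \<sigma>_M _ _ _ s])
      show "v \<in> V0" "?\<sigma> v \<in> U" using elim by auto
      show "\<epsilon> - dist (?\<sigma> v) b > 0" using elim by simp
      fix \<beta>' assume \<beta>': "\<beta>' \<in> M" "dist \<beta>' (?\<sigma> v) < \<epsilon> - dist (?\<sigma> v) b"
      have "dist \<beta>' b \<le> dist \<beta>' (?\<sigma> v) + dist (?\<sigma> v) b"
        by (rule dist_triangle)
      then have "\<beta>' \<in> M \<inter> cball b \<epsilon>"
        using \<beta>' by (simp add: dist_commute)
      then show "f (?\<sigma> v) - v \<bullet> ?\<sigma> v \<le> f \<beta>' - v \<bullet> \<beta>'"
        using \<sigma>[of v] elim by (simp add: tilt_argmin_def is_minimizer_def)
    qed
    then show ?case by simp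
  qed
  have "H (L z) \<bullet> w = z \<bullet> w" if w: "w \<in> tangent_space M b" for z w
  proof -
    define s where "s = \<Phi>' b w"
    have s: "s \<in> S" and w_eq: "w = \<Psi>' (\<Phi> b) s"
      using w by (simp_all add: s_def tangent_space_eq \<Psi>'\<Phi>' b_U)
    obtain \<Psi>'' where \<Psi>'': "(\<Psi>' has_derivative \<Psi>'') (at (\<Phi> b))"
      using C1_onE[OF \<Psi>'_C1] \<Phi>_V[OF b_U] by blast
    have "(\<Phi> has_derivative \<Phi>' b) (at (?\<sigma> 0))"
      using \<Phi>'[OF b_U] by (simp add: \<sigma>0)
    from has_derivative_compose[OF L this]
    have "((\<lambda>v. \<Phi> (?\<sigma> v)) has_derivative (\<lambda>z. \<Phi>' b (L z))) (at 0)" .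
    moreover have "(\<Psi>' has_derivative \<Psi>'') (at (\<Phi> (?\<sigma> 0)))"
      using \<Psi>'' by (simp add: \<sigma>0)
    ultimately have "((\<lambda>v. \<Psi>' (\<Phi> (?\<sigma> v))) has_derivative (\<lambda>z. \<Psi>'' (\<Phi>' b (L z)))) (at 0)"
      by (rule has_derivative_compose)
    from blinfun.FDERIV[OF this has_derivative_const[of s]]
    have B: "((\<lambda>v. \<Psi>' (\<Phi> (?\<sigma> v)) s) has_derivative (\<lambda>z. \<Psi>'' (\<Phi>' b (L z)) s)) (at 0)"
      by (simp add: blinfun.zero_right)
    have "(G has_derivative H) (at (?\<sigma> 0))"
      using H by (simp add: \<sigma>0)
    from has_derivative_diff[OF has_derivative_compose[OF L this] has_derivative_ident]
    have R: "((\<lambda>v. G (?\<sigma> v) - v) has_derivative (\<lambda>z. H (L z) - z)) (at 0)" .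
    \<comment> \<open>In the product rule the derivative of \<open>\<Psi>'\<close> is paired with
      \<open>G b - 0 = 0\<close>, so the second derivative of the chart disappears.\<close>
    have 1: "((\<lambda>v. (G (?\<sigma> v) - v) \<bullet> \<Psi>' (\<Phi> (?\<sigma> v)) s) has_derivative (\<lambda>z. (H (L z) - z) \<bullet> w)) (at 0)"
      using has_derivative_inner[OF R B] by (simp add: \<sigma>0 G_b w_eq)
    obtain N where N: "open N" "0 \<in> N"
      "\<And>v. v \<in> N \<Longrightarrow> 0 = (G (?\<sigma> v) - v) \<bullet> \<Psi>' (\<Phi> (?\<sigma> v)) s"
      using crit[OF s] unfolding eventually_nhds by blast
    have "((\<lambda>v. (G (?\<sigma> v) - v) \<bullet> \<Psi>' (\<Phi> (?\<sigma> v)) s) has_derivative (\<lambda>z. 0)) (at 0)"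
      by (rule has_derivative_transform_within_open[OF has_derivative_const N])
    from has_derivative_unique[OF 1 this]
    have "(H (L z) - z) \<bullet> w = 0"
      by (rule fun_cong)
    then show ?thesis by (simp add: inner_diff_left)
  qed
  with L L_T show ?thesis using that by blast
qed

text \<open>The critical points of the tilt by \<open>v\<close> are the points \<open>\<beta>\<close> with
  \<open>v - G \<beta>\<close> normal to \<open>M\<close>. Writing normals as
  \<open>blinfun_adjoint (\<Phi>' \<beta>) n\<close> with \<open>n\<close> orthogonal to \<open>S\<close> and collecting
  \<open>\<Phi> \<beta>\<close> and \<open>n\<close> into one vector \<open>u\<close> of the ambient space, they become the solutions of
  \<open>X u = v\<close> for the map \<open>X\<close> below, to which the inverse function theorem applies.\<close>

lemma critical_point_solution:
  assumes H: "(G has_derivative H) (at b)"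
    and pos: "\<And>w. w \<in> tangent_space M b \<Longrightarrow> w \<noteq> 0 \<Longrightarrow> w \<bullet> H w > 0"
  obtains d \<tau> where "d > 0" "ball b d \<subseteq> U" "C1_on (ball 0 d) \<tau>"
    "\<And>\<beta> v. \<beta> \<in> M \<Longrightarrow> dist \<beta> b < d \<Longrightarrow> norm v < d \<Longrightarrow>
      (\<And>s. s \<in> S \<Longrightarrow> (G \<beta> - v) \<bullet> \<Psi>' (\<Phi> \<beta>) s = 0) \<Longrightarrow> \<beta> = \<tau> v"
proof -
  define P where "P = orth_proj S"
  have P: "bounded_linear P" and P_S: "P u \<in> S" and P_id: "u \<in> S \<Longrightarrow> P u = u"
    and P_orth: "s \<in> S \<Longrightarrow> (u - P u) \<bullet> s = 0" for u s
    using S by (simp_all add: P_def bounded_linear_orth_proj orth_proj_in orth_proj_id orth_proj_orthogonal)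
  interpret P: bounded_linear P by fact
  define u0 where "u0 = \<Phi> b"
  have u0: "u0 \<in> S" "u0 \<in> V" "P u0 = u0" "\<Psi> u0 = b"
    using \<Phi>_S[OF b_M b_U] \<Phi>_V[OF b_U] \<Psi>\<Phi>[OF b_U] P_id by (simp_all add: u0_def)
  define Z where "Z = (\<lambda>u. \<Psi> (P u))"
  define X where "X = (\<lambda>u. G (Z u) + blinfun_adjoint (\<Phi>' (Z u)) (u - P u))"
  define V1 where "V1 = P -` V"
  have V1: "open V1" "u0 \<in> V1"
    unfolding V1_def using u0 open_vimage[OF open_V linear_continuous_on[OF P]] by auto
  have bl_diff: "bounded_linear (\<lambda>u. u - P u)"
    by (intro bounded_linear_sub bounded_linear_ident P)
  have Z_C1: "C1_on V1 Z"
    unfolding Z_def by (rule C1_on_compose[OF C1_on_bounded_linear[OF P] C1_\<Psi>]) (auto simp: V1_def)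
  have Z_U: "Z ` V1 \<subseteq> U"
    by (auto simp: Z_def V1_def \<Psi>_U)
  have X_C1: "C1_on V1 X"
    unfolding X_def
    by (intro C1_on_add C1_on_bilinear[OF bounded_bilinear_blinfun_adjoint] C1_on_bounded_linear[OF bl_diff]
        C1_on_compose[OF Z_C1 G_C1 Z_U] C1_on_compose[OF Z_C1 \<Phi>'_C1 Z_U])
  define D where "D = (\<lambda>x. H (\<Psi>' u0 (P x)) + blinfun_adjoint (\<Phi>' b) (x - P x))"
  have X': "(X has_derivative D) (at u0)"
  proof -
    have "(\<Psi> has_derivative blinfun_apply (\<Psi>' u0)) (at (P u0))"
      using \<Psi>'[OF u0(2)] u0(3) by simp
    from has_derivative_compose[OF bounded_linear_imp_has_derivative[OF P] this]
    have Z': "(Z has_derivative (\<lambda>x. \<Psi>' u0 (P x))) (at u0)"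
      unfolding Z_def .
    have Zu0: "Z u0 = b" by (simp add: Z_def u0)
    have "(G has_derivative H) (at (Z u0))"
      using H Zu0 by simp
    from has_derivative_compose[OF Z' this]
    have 1: "((\<lambda>u. G (Z u)) has_derivative (\<lambda>x. H (\<Psi>' u0 (P x)))) (at u0)" .
    obtain E where E: "((\<lambda>u. \<Phi>' (Z u)) has_derivative E) (at u0)"
      using C1_onE[OF C1_on_compose[OF Z_C1 \<Phi>'_C1 Z_U]] V1(2) by blast
    interpret adj: bounded_bilinear "blinfun_adjoint :: ('a \<Rightarrow>\<^sub>L 'a) \<Rightarrow> 'a \<Rightarrow> 'a"
      by (rule bounded_bilinear_blinfun_adjoint)
    \<comment> \<open>The term with \<open>E\<close> drops out because the normal part
      \<open>u0 - P u0\<close> is zero.\<close>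
    have 2: "((\<lambda>u. blinfun_adjoint (\<Phi>' (Z u)) (u - P u)) has_derivative
        (\<lambda>x. blinfun_adjoint (\<Phi>' b) (x - P x))) (at u0)"
      using adj.FDERIV[OF E bounded_linear_imp_has_derivative[OF bl_diff]]
      by (simp add: Zu0 u0(3))
    show ?thesis
      unfolding X_def D_def by (rule has_derivative_add[OF 1 2])
  qed
  \<comment> \<open>Pairing with the tangent vector \<open>?w\<close> removes the normal part, as
    \<open>\<Phi>' b ?w\<close> lies in \<open>S\<close>; positivity forces \<open>?w = 0\<close>,
    hence \<open>P x = 0\<close>. Pairing with \<open>\<Psi>' u0 x\<close> then leaves
    \<open>x \<bullet> x = 0\<close>.\<close>
  have inj: "x = 0" if x: "D x = 0" for x
  proof -
    let ?w = "\<Psi>' u0 (P x)"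
    have w: "?w \<in> tangent_space M b" and \<Phi>'w: "\<Phi>' b ?w = P x"
      using \<Psi>'_tangent[OF P_S] \<Phi>'\<Psi>'[OF b_U] by (simp_all add: u0_def)
    have D_inner: "H ?w \<bullet> y + \<Phi>' b y \<bullet> (x - P x) = 0" for y
    proof -
      have "D x \<bullet> y = 0" using x by simp
      then show ?thesis by (simp add: D_def inner_add_left blinfun_adjoint_inner)
    qed
    have "?w \<bullet> H ?w = 0"
      using D_inner[of ?w] P_orth[OF P_S, of x x] by (simp add: \<Phi>'w inner_commute)
    then have w0: "?w = 0" using pos[OF w] by fastforce
    then have Px: "P x = 0" using \<Phi>'w by (simp add: blinfun.zero_right)
    have "H 0 = 0" using has_derivative_linear[OF H] by (rule linear_0)
    then have "\<Phi>' b (\<Psi>' u0 x) \<bullet> x = 0"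
      using D_inner[of "\<Psi>' u0 x"] w0 Px by simp
    then show ?thesis using \<Phi>'\<Psi>'[OF b_U] by (simp add: u0_def)
  qed
  have Xu0: "X u0 = 0"
    by (simp add: X_def Z_def u0 G_b)
  obtain U' W Y where IFT: "open U'" "U' \<subseteq> V1" "u0 \<in> U'" "open W" "X u0 \<in> W"
    "homeomorphism U' W X Y" "C1_on W Y"
    using C1_inverse_function[OF V1(1) X_C1 V1(2) X' inj] by metis
  have Y: "\<And>v. v \<in> W \<Longrightarrow> Y v \<in> U'" "\<And>u. u \<in> U' \<Longrightarrow> Y (X u) = u"
    using IFT(6) unfolding homeomorphism_def by auto
  \<comment> \<open>Candidate preimage of \<open>v\<close> under \<open>X\<close>: the chart image
    of the critical point plus its multiplier, recovered from \<open>v - G \<beta>\<close> by the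
    adjoint of \<open>\<Psi>'\<close>, which inverts that of \<open>\<Phi>'\<close>. By continuity,
    pairs near \<open>(b, 0)\<close> land in \<open>U'\<close>, where \<open>X\<close> is
    injective.\<close>
  define \<nu> where "\<nu> = (\<lambda>p. \<Phi> (fst p) + blinfun_adjoint (\<Psi>' (\<Phi> (fst p))) (snd p - G (fst p)))"
  have C1_\<Phi>: "C1_on U \<Phi>"
    unfolding C1_on_def using \<Phi>' C1_on_imp_continuous_on[OF \<Phi>'_C1] by blast
  have fst_on: "continuous_on (U \<times> UNIV) (\<lambda>p::'a \<times> 'a. c (fst p))" if "continuous_on U c"
    for c :: "'a \<Rightarrow> 'c::topological_space"
    by (rule continuous_on_compose2[OF that continuous_on_fst]) (auto intro: continuous_intros)
  have "continuous_on U (\<lambda>\<beta>. \<Psi>' (\<Phi> \<beta>))"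
    by (rule continuous_on_compose2[OF C1_on_imp_continuous_on[OF \<Psi>'_C1] C1_on_imp_continuous_on[OF C1_\<Phi>]])
      (auto simp: \<Phi>_V)
  then have \<nu>_cont: "continuous_on (U \<times> UNIV) \<nu>"
    unfolding \<nu>_def
    by (intro continuous_on_add continuous_on_diff continuous_on_snd continuous_on_id
        bounded_bilinear.continuous_on[OF bounded_bilinear_blinfun_adjoint] fst_on
        C1_on_imp_continuous_on[OF G_C1] C1_on_imp_continuous_on[OF C1_\<Phi>])
  have "open ((U \<times> UNIV) \<inter> \<nu> -` U')"
    using continuous_open_preimage[OF \<nu>_cont _ IFT(1)] open_U by (simp add: open_Times)
  moreover have "(b, 0) \<in> (U \<times> UNIV) \<inter> \<nu> -` U'"
    using IFT(3) b_U by (simp add: \<nu>_def G_b u0_def)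
  ultimately obtain A B where AB: "open A" "open B" "b \<in> A" "0 \<in> B" "A \<times> B \<subseteq> (U \<times> UNIV) \<inter> \<nu> -` U'"
    by (rule open_prod_elim) blast
  obtain d1 where d1: "d1 > 0" "ball b d1 \<subseteq> A"
    using openE[OF AB(1,3)] by blast
  obtain d2 where d2: "d2 > 0" "ball 0 d2 \<subseteq> B \<inter> W"
    using openE[OF open_Int[OF AB(2) IFT(4)], of 0] AB(4) IFT(5) Xu0 by auto
  define d where "d = min d1 d2"
  have sub: "ball b d \<subseteq> A" "ball 0 d \<subseteq> B \<inter> W"
    using d1 d2 by (auto simp: d_def)
  \<comment> \<open>Only uniqueness is asserted of \<open>\<tau>\<close>; the existence of
    minimizers is left to compactness.\<close>
  show ?thesis
  proof (rule that[of d "\<lambda>v. \<Psi> (P (Y v))"])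
    show "d > 0" using d1 d2 by (simp add: d_def)
    show "ball b d \<subseteq> U" using sub AB(4,5) by blast
    show "C1_on (ball 0 d) (\<lambda>v. \<Psi> (P (Y v)))"
    proof (rule C1_on_compose[where g = "\<lambda>u. \<Psi> (P u)" and W = V1])
      show "C1_on (ball 0 d) Y" using C1_on_subset[OF IFT(7)] sub by blast
      show "C1_on V1 (\<lambda>u. \<Psi> (P u))" using Z_C1 by (simp add: Z_def)
      show "Y ` ball 0 d \<subseteq> V1" using sub Y(1) IFT(2) by blast
    qed
    fix \<beta> v assume \<beta>: "\<beta> \<in> M" "dist \<beta> b < d" and v: "norm v < d"
      and crit: "\<And>s. s \<in> S \<Longrightarrow> (G \<beta> - v) \<bullet> \<Psi>' (\<Phi> \<beta>) s = 0"
    have "\<beta> \<in> A" "v \<in> B"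
      using \<beta> v sub by (auto simp: dist_commute subset_iff)
    then have \<beta>U: "\<beta> \<in> U" and \<nu>U': "\<nu> (\<beta>, v) \<in> U'"
      using AB(5) by auto
    let ?n = "blinfun_adjoint (\<Psi>' (\<Phi> \<beta>)) (v - G \<beta>)"
    have n_orth: "?n \<bullet> s = 0" if "s \<in> S" for s
      using crit[OF that] by (simp add: blinfun_adjoint_inner inner_diff_left inner_diff_right
          inner_commute[of "\<Psi>' (\<Phi> \<beta>) s"])
    \<comment> \<open>Criticality enters here: it makes the multiplier orthogonal to
      \<open>S\<close>, so projecting onto \<open>S\<close> returns
      \<open>\<Phi> \<beta>\<close>.\<close>
    have P\<nu>: "P (\<nu> (\<beta>, v)) = \<Phi> \<beta>"
      unfolding P_def by (rule orth_proj_eqI[OF S \<Phi>_S[OF \<beta>(1) \<beta>U]]) (simp add: \<nu>_def n_orth)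
    have "X (\<nu> (\<beta>, v)) \<bullet> y = v \<bullet> y" for y
    proof -
      have "X (\<nu> (\<beta>, v)) \<bullet> y = G \<beta> \<bullet> y + \<Phi>' \<beta> y \<bullet> ?n"
        by (simp add: X_def Z_def P\<nu> \<Psi>\<Phi> \<beta>U inner_add_left blinfun_adjoint_inner)
          (simp add: \<nu>_def)
      also have "\<Phi>' \<beta> y \<bullet> ?n = \<Psi>' (\<Phi> \<beta>) (\<Phi>' \<beta> y) \<bullet> (v - G \<beta>)"
        by (metis blinfun_adjoint_inner inner_commute)
      finally show ?thesis
        by (simp add: \<Psi>'\<Phi>' \<beta>U inner_diff_right inner_commute)
    qed
    then have "X (\<nu> (\<beta>, v)) = v"
      using vector_eq_rdot by blast
    then have "Y v = \<nu> (\<beta>, v)"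
      using Y(2)[OF \<nu>U'] by simp
    then show "\<beta> = \<Psi> (P (Y v))"
      by (simp add: P\<nu> \<Psi>\<Phi> \<beta>U)
  qed
qed

text \<open>\<open>M\<close> itself need not be closed, but inside the chart it is the preimage of
  the closed subspace \<open>S\<close>.\<close>

lemma compact_slice:
  assumes "cball b r \<subseteq> U"
  shows "compact (M \<inter> cball b r)"
proof -
  have "continuous_on (cball b r) \<Phi>"
    using homeo assms unfolding homeomorphism_def by (meson continuous_on_subset)
  then have "closed (cball b r \<inter> \<Phi> -` S)"
    by (rule continuous_closed_preimage[OF _ closed_cball closed_subspace[OF S]])
  moreover have "M \<inter> cball b r = cball b r \<inter> \<Phi> -` S"
    using assms \<Phi>_S \<Psi>_M \<Phi>_V \<Psi>\<Phi> by fastforce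
  ultimately have "closed (M \<inter> cball b r)" by simp
  then have "compact (cball b r \<inter> (M \<inter> cball b r))"
    by (intro compact_Int_closed compact_cball)
  then show ?thesis by (simp add: Int_commute Int_left_commute)
qed

lemma continuous_on_objective: "continuous_on (M \<inter> U) f"
proof -
  have "continuous_on (M \<inter> U) g"
    using grad unfolding gderiv_def
    by (intro continuous_at_imp_continuous_on ballI) (blast dest: has_derivative_continuous)
  then show ?thesis
    using continuous_on_cong[OF refl, of "M \<inter> U" f g] ext by simp
qed

text \<open>A point of the ball doing as well as \<open>b\<close> is critical for the zero tilt and
  so equals \<open>\<tau> 0\<close>; hence \<open>b\<close> is a strict minimizer there. This yields
  a gap on the bounding sphere that small tilts cannot close.\<close>

theorem tilt_stable_radius_exists:
  assumes min: "is_minimizer M f b" and H: "(G has_derivative H) (at b)"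
    and pos: "\<And>w. w \<in> tangent_space M b \<Longrightarrow> w \<noteq> 0 \<Longrightarrow> w \<bullet> H w > 0"
  shows "\<exists>\<epsilon>. tilt_stable_radius M f b \<epsilon>"
proof -
  obtain d \<tau> where d: "d > 0" "ball b d \<subseteq> U" "C1_on (ball 0 d) \<tau>"
    and \<tau>: "\<And>\<beta> v. \<beta> \<in> M \<Longrightarrow> dist \<beta> b < d \<Longrightarrow> norm v < d \<Longrightarrow>
      (\<And>s. s \<in> S \<Longrightarrow> (G \<beta> - v) \<bullet> \<Psi>' (\<Phi> \<beta>) s = 0) \<Longrightarrow> \<beta> = \<tau> v"
    using critical_point_solution[OF H pos] by blast
  define \<epsilon> where "\<epsilon> = d / 2"
  have eps: "\<epsilon> > 0" "cball b \<epsilon> \<subseteq> ball b d"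
    using d(1) by (auto simp: \<epsilon>_def)
  then have cU: "cball b \<epsilon> \<subseteq> U" using d(2) by blast
  have near: "dist \<beta> b < d" "\<beta> \<in> U" if "\<beta> \<in> cball b \<epsilon>" for \<beta>
    using that d(1) cU by (auto simp: \<epsilon>_def dist_commute)
  have minb: "f b \<le> f \<beta>" if "\<beta> \<in> M" for \<beta>
    using min that by (simp add: is_minimizer_def)
  \<comment> \<open>Such a point minimizes \<open>f\<close> over all of \<open>M\<close>, so it is
    critical even if it lies on the bounding sphere; the radius 1 below is an arbitrary
    choice.\<close>
  have glob: "\<beta> = \<tau> 0" if "\<beta> \<in> M" "\<beta> \<in> cball b \<epsilon>" "f \<beta> \<le> f b" for \<beta>
  proof (rule \<tau>)
    show "\<beta> \<in> M" "dist \<beta> b < d" "norm (0::'a) < d"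
      using that near d(1) by auto
    show "(G \<beta> - 0) \<bullet> \<Psi>' (\<Phi> \<beta>) s = 0" if "s \<in> S" for s
    proof (rule tilted_critical[OF \<open>\<beta> \<in> M\<close> near(2) zero_less_one _ that])
      show "\<beta> \<in> cball b \<epsilon>" by fact
      show "f \<beta> - 0 \<bullet> \<beta> \<le> f \<beta>' - 0 \<bullet> \<beta>'" if "\<beta>' \<in> M" for \<beta>'
        using \<open>f \<beta> \<le> f b\<close> minb[OF that] by simp
    qed
  qed
  have \<tau>0: "\<tau> 0 = b"
    using glob[of b] b_M eps(1) by simp
  let ?R = "M \<inter> sphere b \<epsilon>"
  have strict: "f b < f \<beta>" if "\<beta> \<in> ?R" for \<beta>
  proof -
    have "\<beta> \<noteq> b" using that eps(1) by auto
    then show ?thesis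
      using glob[of \<beta>] \<tau>0 that by fastforce
  qed
  have comp: "compact (M \<inter> cball b \<epsilon>)" by (rule compact_slice[OF cU])
  have "M \<inter> cball b \<epsilon> \<subseteq> M \<inter> U" using cU by blast
  then have fcont: "continuous_on (M \<inter> cball b \<epsilon>) f"
    using continuous_on_objective continuous_on_subset by blast
  have "\<exists>m>0. \<forall>\<beta>\<in>?R. f b + m \<le> f \<beta>"
  proof (cases "?R = {}")
    case True
    then show ?thesis by (intro exI[of _ 1]) auto
  next
    case False
    have eq: "?R = (M \<inter> cball b \<epsilon>) \<inter> sphere b \<epsilon>" by auto
    have R: "compact ?R"
      unfolding eq by (intro compact_Int_closed comp closed_sphere)
    have "continuous_on ?R f"
      using fcont by (rule continuous_on_subset) auto
    then obtain x where "x \<in> ?R" "\<And>y. y \<in> ?R \<Longrightarrow> f x \<le> f y"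
      using continuous_attains_inf[OF R False] by blast
    then show ?thesis
      using strict[of x] by (intro exI[of _ "f x - f b"]) auto
  qed
  then obtain m where m: "m > 0" "\<And>\<beta>. \<beta> \<in> ?R \<Longrightarrow> f b + m \<le> f \<beta>" by blast
  \<comment> \<open>A tilt by \<open>v\<close> shifts the comparison with \<open>b\<close> by at
    most \<open>norm v * \<epsilon>\<close> on the ball. The bound \<open>m / \<epsilon>\<close>
    keeps this below the gap \<open>m\<close>, and \<open>d\<close> keeps \<open>\<tau>\<close>
    applicable.\<close>
  define r where "r = min d (m / \<epsilon>)"
  have r: "r > 0" using d(1) m(1) eps(1) by (simp add: r_def)
  have argmin: "tilt_argmin M f b \<epsilon> v = {\<tau> v}" if v: "norm v < r" for v
  proof -
    let ?q = "\<lambda>\<beta>. f \<beta> - v \<bullet> \<beta>"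
    have "continuous_on (M \<inter> cball b \<epsilon>) ?q"
      by (intro continuous_on_diff fcont continuous_intros)
    moreover have "M \<inter> cball b \<epsilon> \<noteq> {}" using b_M eps(1) by auto
    ultimately have "\<exists>\<beta>. \<beta> \<in> tilt_argmin M f b \<epsilon> v"
      using continuous_attains_inf[OF comp] by (fastforce simp: tilt_argmin_def is_minimizer_def)
    moreover have "\<beta> = \<tau> v" if \<beta>: "\<beta> \<in> tilt_argmin M f b \<epsilon> v" for \<beta>
    proof -
      have \<beta>M: "\<beta> \<in> M" and \<beta>c: "\<beta> \<in> cball b \<epsilon>"
        and le: "\<And>\<beta>'. \<beta>' \<in> M \<Longrightarrow> \<beta>' \<in> cball b \<epsilon> \<Longrightarrow> ?q \<beta> \<le> ?q \<beta>'"
        using \<beta> by (auto simp: tilt_argmin_def is_minimizer_def)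
      have "f \<beta> - f b \<le> v \<bullet> (\<beta> - b)"
        using le[of b] b_M eps(1) by (simp add: inner_diff_right)
      also have "\<dots> \<le> norm v * norm (\<beta> - b)" by (rule norm_cauchy_schwarz)
      also have "\<dots> \<le> norm v * \<epsilon>"
        using \<beta>c by (intro mult_left_mono) (auto simp: dist_norm norm_minus_commute)
      also have "\<dots> < (m / \<epsilon>) * \<epsilon>"
        using v eps(1) by (intro mult_strict_right_mono) (auto simp: r_def)
      also have "\<dots> = m" using eps(1) by simp
      finally have "\<beta> \<notin> sphere b \<epsilon>" using m(2)[of \<beta>] \<beta>M by fastforce
      then have int: "\<epsilon> - dist \<beta> b > 0" using \<beta>c by (simp add: dist_commute)
      show ?thesis
      proof (rule \<tau>[OF \<beta>M near(1)[OF \<beta>c]])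
        show "norm v < d" using v by (simp add: r_def)
        show "(G \<beta> - v) \<bullet> \<Psi>' (\<Phi> \<beta>) s = 0" if "s \<in> S" for s
        proof (rule tilted_critical[OF \<beta>M near(2)[OF \<beta>c] int _ that])
          fix \<beta>' assume \<beta>': "\<beta>' \<in> M" "dist \<beta>' \<beta> < \<epsilon> - dist \<beta> b"
          then have "\<beta>' \<in> cball b \<epsilon>"
            using dist_triangle[of \<beta>' b \<beta>] by (simp add: dist_commute)
          then show "?q \<beta> \<le> ?q \<beta>'" using le \<beta>' by blast
        qed
      qed
    qed
    ultimately show ?thesis by blast
  qed
  have "tilt_stable_radius M f b \<epsilon>"
    unfolding tilt_stable_radius_def
  proof (intro conjI exI[of _ "ball 0 r"] ballI)
    show "tilt_argmin M f b \<epsilon> 0 = {b}" using argmin[of 0] r \<tau>0 by simp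
    show "\<exists>\<beta>. tilt_argmin M f b \<epsilon> v = {\<beta>}" if "v \<in> ball 0 r" for v
      using argmin[of v] that by auto
    have "C1_on (ball 0 r) \<tau>"
      by (rule C1_on_subset[OF d(3)]) (simp add: r_def subset_ball)
    then show "C1_on (ball 0 r) (tilt_solution M f b \<epsilon>)"
      by (rule C1_on_cong[OF open_ball, rotated]) (simp add: tilt_solution_def argmin)
  qed (use eps(1) r in auto)
  then show ?thesis ..
qed

end

text \<open>The slice chart and the extension of \<open>\<phi>\<close> live on different
  neighborhoods, so both are cut down to the common part, and \<open>V\<close> accordingly.
  Subtracting the linear term with \<open>G\<^sub>0\<close> cancels the gradient at \<open>b\<close>
  and leaves the Hessian unchanged.\<close>

lemma tilted_chart_exists:
  fixes M :: "(real^'d) set"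
  assumes manifold: "C2_submanifold k M" and b: "b \<in> M"
    and ext: "has_gradient_hessian_ext M \<phi> b G\<^sub>0 H"
    and f: "\<And>\<beta>. \<beta> \<in> M \<Longrightarrow> f \<beta> = \<phi> \<beta> - G\<^sub>0 \<bullet> \<beta>"
  obtains U V S \<Phi> \<Psi> G \<Phi>' \<Psi>' g where "tilted_chart M U V S b \<Phi> \<Psi> G \<Phi>' \<Psi>' f g"
    "(G has_derivative (\<lambda>v. H *v v)) (at b)"
proof -
  obtain U0 V0 :: "(real^'d) set" and \<Phi> \<Psi> S where ch: "open U0" "b \<in> U0" "open V0"
    "homeomorphism U0 V0 \<Phi> \<Psi>" "C2_on U0 \<Phi>" "C2_on V0 \<Psi>" "subspace S" "\<Phi> ` (M \<inter> U0) = S \<inter> V0"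
    using bspec[OF manifold[unfolded C2_submanifold_def] b] by (elim exE conjE) (rule that)
  obtain U1 g1 G1 where ex: "open U1" "b \<in> U1" "C2_on U1 g1" "\<And>\<beta>. \<beta> \<in> M \<inter> U1 \<Longrightarrow> g1 \<beta> = \<phi> \<beta>"
    "\<And>\<beta>. \<beta> \<in> U1 \<Longrightarrow> GDERIV g1 \<beta> :> G1 \<beta>" "G1 b = G\<^sub>0" "(G1 has_derivative (\<lambda>v. H *v v)) (at b)"
    using ext unfolding has_gradient_hessian_ext_def by blast
  obtain \<Phi>' where \<Phi>': "\<And>x. x \<in> U0 \<Longrightarrow> (\<Phi> has_derivative blinfun_apply (\<Phi>' x)) (at x)" "C1_on U0 \<Phi>'"
    using ch(5) unfolding C2_on_def by blast
  obtain \<Psi>' where \<Psi>': "\<And>x. x \<in> V0 \<Longrightarrow> (\<Psi> has_derivative blinfun_apply (\<Psi>' x)) (at x)" "C1_on V0 \<Psi>'"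
    using ch(6) unfolding C2_on_def by blast
  define U where "U = U0 \<inter> U1"
  define V where "V = V0 \<inter> \<Psi> -` U1"
  have \<Psi>_cont: "continuous_on V0 \<Psi>"
    and \<Psi>\<Phi>: "\<And>x. x \<in> U0 \<Longrightarrow> \<Psi> (\<Phi> x) = x" and \<Phi>\<Psi>: "\<And>y. y \<in> V0 \<Longrightarrow> \<Phi> (\<Psi> y) = y"
    and \<Phi>V: "\<And>x. x \<in> U0 \<Longrightarrow> \<Phi> x \<in> V0" and \<Psi>U: "\<And>y. y \<in> V0 \<Longrightarrow> \<Psi> y \<in> U0"
    using ch(4) unfolding homeomorphism_def by auto
  have \<Phi>U_eq: "\<Phi> ` U = V"
  proof
    show "\<Phi> ` U \<subseteq> V" using \<Psi>\<Phi> \<Phi>V by (auto simp: U_def V_def)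
    show "V \<subseteq> \<Phi> ` U"
    proof
      fix y assume "y \<in> V"
      then have "\<Psi> y \<in> U" "y = \<Phi> (\<Psi> y)" using \<Phi>\<Psi> \<Psi>U by (auto simp: U_def V_def)
      then show "y \<in> \<Phi> ` U" by blast
    qed
  qed
  have "tilted_chart M U V S b \<Phi> \<Psi> (\<lambda>\<beta>. G1 \<beta> - G\<^sub>0) \<Phi>' \<Psi>' f (\<lambda>\<beta>. g1 \<beta> - G\<^sub>0 \<bullet> \<beta>)"
  proof
    show "open U" using ch(1) ex(1) by (simp add: U_def open_Int)
    show "open V" unfolding V_def by (rule continuous_open_preimage[OF \<Psi>_cont ch(3) ex(1)])
    show "b \<in> M" "b \<in> U" using b ch(2) ex(2) by (simp_all add: U_def)
    show "homeomorphism U V \<Phi> \<Psi>"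
      by (rule homeomorphism_of_subsets[OF ch(4) _ subset_refl \<Phi>U_eq]) (auto simp: U_def)
    show "(\<Phi> has_derivative blinfun_apply (\<Phi>' x)) (at x)" if "x \<in> U" for x
      using \<Phi>'(1) that by (simp add: U_def)
    show "C1_on U \<Phi>'" by (rule C1_on_subset[OF \<Phi>'(2)]) (simp add: U_def)
    show "(\<Psi> has_derivative blinfun_apply (\<Psi>' x)) (at x)" if "x \<in> V" for x
      using \<Psi>'(1) that by (simp add: V_def)
    show "C1_on V \<Psi>'" by (rule C1_on_subset[OF \<Psi>'(2)]) (simp add: V_def)
    show "subspace S" by (rule ch(7))
    show "\<Phi> ` (M \<inter> U) = S \<inter> V"
    proof
      show "\<Phi> ` (M \<inter> U) \<subseteq> S \<inter> V"
        using ch(8) \<Phi>U_eq by (auto simp: U_def)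
      show "S \<inter> V \<subseteq> \<Phi> ` (M \<inter> U)"
      proof
        fix y assume y: "y \<in> S \<inter> V"
        then have "y \<in> \<Phi> ` (M \<inter> U0)" using ch(8) by (simp add: V_def)
        then obtain x where x: "x \<in> M" "x \<in> U0" "y = \<Phi> x" by blast
        then have "x \<in> U1" using y \<Psi>\<Phi> by (auto simp: V_def)
        then show "y \<in> \<Phi> ` (M \<inter> U)" using x by (auto simp: U_def)
      qed
    qed
    show "g1 \<beta> - G\<^sub>0 \<bullet> \<beta> = f \<beta>" if "\<beta> \<in> M \<inter> U" for \<beta>
      using that ex(4) f by (simp add: U_def)
    show "GDERIV (\<lambda>\<beta>. g1 \<beta> - G\<^sub>0 \<bullet> \<beta>) \<beta> :> G1 \<beta> - G\<^sub>0" if "\<beta> \<in> U" for \<beta>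
    proof -
      have "((\<lambda>\<beta>. G\<^sub>0 \<bullet> \<beta>) has_derivative (\<lambda>h. G\<^sub>0 \<bullet> h)) (at \<beta>)"
        by (rule has_derivative_inner_right[OF has_derivative_ident])
      from has_derivative_diff[OF ex(5)[unfolded gderiv_def] this] that
      show ?thesis
        unfolding gderiv_def by (simp add: U_def inner_diff_right inner_commute)
    qed
    have "C1_on U G1"
      by (rule C1_on_subset[OF C1_on_gradient[OF ex(1,3,5)]]) (auto simp: U_def)
    from C1_on_add[OF this C1_on_const[of U "- G\<^sub>0"]]
    show "C1_on U (\<lambda>\<beta>. G1 \<beta> - G\<^sub>0)" by simp
    show "G1 b - G\<^sub>0 = 0" using ex(6) by simp
  qed
  moreover have "((\<lambda>\<beta>. G1 \<beta> - G\<^sub>0) has_derivative (\<lambda>v. H *v v)) (at b)"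
    using has_derivative_diff[OF ex(7) has_derivative_const[of G\<^sub>0]] by simp
  ultimately show ?thesis using that by blast
qed

section \<open>Tilt-stability without reference to charts\<close>

context
  fixes M :: "(real^'d) set" and k b \<phi> G\<^sub>0 H f
  assumes chart: "C2_submanifold k M" "b \<in> M" "has_gradient_hessian_ext M \<phi> b G\<^sub>0 H"
    "\<And>\<beta>. \<beta> \<in> M \<Longrightarrow> f \<beta> = \<phi> \<beta> - G\<^sub>0 \<bullet> \<beta>"
begin

lemma subspace_tangent_space: "subspace (tangent_space M b)"
  using tilted_chart_exists[OF chart] tilted_chart.subspace_tangent_space by metis

lemma tilt_stable_minimizerI:
  assumes "is_minimizer M f b"
    and "\<And>w. w \<in> tangent_space M b \<Longrightarrow> w \<noteq> 0 \<Longrightarrow> w \<bullet> (H *v w) > 0"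
  shows "tilt_stable_minimizer M f b"
proof -
  obtain U V S \<Phi> \<Psi> G \<Phi>' \<Psi>' g where 1: "tilted_chart M U V S b \<Phi> \<Psi> G \<Phi>' \<Psi>' f g"
    and 2: "(G has_derivative (\<lambda>v. H *v v)) (at b)"
    using tilted_chart_exists[OF chart] by metis
  show ?thesis
    unfolding tilt_stable_minimizer_def
    using tilted_chart.tilt_stable_radius_exists[OF 1 assms(1) 2 assms(2)] assms(1) by blast
qed

text \<open>The radius picked by \<open>SOME\<close> in \<open>REG\<close> is one admissible radius,
  and the derivative formula holds for each of them. The modulus thus becomes the norm of an
  operator described by \<open>H\<close> and the tangent space.\<close>

lemma tilt_stable_REG:
  assumes "tilt_stable_minimizer M f b"
  obtains L where "bounded_linear L" "REG M f b = ennreal (onorm L)"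
    "\<And>z. L z \<in> tangent_space M b"
    "\<And>z w. w \<in> tangent_space M b \<Longrightarrow> (H *v L z) \<bullet> w = z \<bullet> w"
proof -
  define \<epsilon> where "\<epsilon> = (SOME \<epsilon>. tilt_stable_radius M f b \<epsilon>)"
  have rad: "tilt_stable_radius M f b \<epsilon>"
    using assms unfolding \<epsilon>_def tilt_stable_minimizer_def by (metis someI_ex)
  obtain U V S \<Phi> \<Psi> G \<Phi>' \<Psi>' g where 1: "tilted_chart M U V S b \<Phi> \<Psi> G \<Phi>' \<Psi>' f g"
    and 2: "(G has_derivative (\<lambda>v. H *v v)) (at b)"
    using tilted_chart_exists[OF chart] by metis
  obtain L where L: "(tilt_solution M f b \<epsilon> has_derivative L) (at 0)"
    "\<And>z. L z \<in> tangent_space M b"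
    "\<And>z w. w \<in> tangent_space M b \<Longrightarrow> (H *v L z) \<bullet> w = z \<bullet> w"
    using tilted_chart.tilt_stable_derivative[OF 1 rad 2] by blast
  have "REG M f b = ennreal (onorm L)"
    using assms frechet_derivative_at[OF L(1)] by (simp add: REG_def \<epsilon>_def)
  then show ?thesis
    using that L has_derivative_bounded_linear by blast
qed

end

section \<open>Minimal eigenvalues\<close>

lemma eigenpair_on_compression_inner:
  assumes T: "subspace T" and eig: "eigenpair_on T (compression T A) l v" and z: "z \<in> T"
  shows "z \<bullet> (A *v v) = l * (z \<bullet> v)"
  using orth_proj_orthogonal[OF T z, of "A *v v"] eig
  by (simp add: eigenpair_on_def compression_def inner_diff_left inner_commute[of z])

text \<open>The minimum of the quadratic form over the unit sphere of \<open>T\<close> is attained, and the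
  first-order condition turns the minimizer into an eigenvector.\<close>

lemma min_eigenvalue_on_compression_le:
  fixes A :: "real^'d^'d"
  assumes T: "subspace T" and v0: "v0 \<in> T" "v0 \<noteq> 0"
    and sym: "\<And>x y. x \<bullet> (A *v y) = y \<bullet> (A *v x)"
    and w: "w \<in> T"
  shows "min_eigenvalue_on T (compression T A) * (w \<bullet> w) \<le> w \<bullet> (A *v w)"
proof -
  let ?q = "\<lambda>w. w \<bullet> (A *v w)"
  have "compact (T \<inter> sphere 0 1)"
    using closed_subspace[OF T] by (simp add: closed_Int_compact)
  moreover have "(1 / norm v0) *\<^sub>R v0 \<in> T \<inter> sphere 0 1"
    using v0 T by (simp add: subspace_scale)
  moreover have "continuous_on (T \<inter> sphere 0 1) ?q"
    by (intro continuous_intros linear_continuous_on matrix_vector_mul_bounded_linear)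
  ultimately obtain e where e: "e \<in> T" "norm e = 1" "\<And>w. w \<in> T \<inter> sphere 0 1 \<Longrightarrow> ?q e \<le> ?q w"
    using continuous_attains_inf[of "T \<inter> sphere 0 1" ?q] by (metis Int_iff empty_iff mem_sphere_0)
  define m where "m = ?q e"
  have ray: "m * (w \<bullet> w) \<le> ?q w" if w: "w \<in> T" for w
  proof (cases "w = 0")
    case False
    have "(1 / norm w) *\<^sub>R w \<in> T \<inter> sphere 0 1"
      using w T False by (simp add: subspace_scale)
    from e(3)[OF this] have "m \<le> ?q w / (norm w * norm w)"
      by (simp add: m_def matrix_vector_mult_scaleR)
    then show ?thesis
      using False by (simp add: field_simps dot_square_norm power2_eq_square)
  qed simp
  have ortho: "(A *v e - m *\<^sub>R e) \<bullet> z = 0" if z: "z \<in> T" for z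
  proof -
    define B where "B = z \<bullet> (A *v e) - m * (z \<bullet> e)"
    define C where "C = ?q z - m * (z \<bullet> z)"
    have pos: "0 \<le> 2 * t * B + t^2 * C" for t
    proof -
      have "e + t *\<^sub>R z \<in> T" using e(1) z T by (simp add: subspace_add subspace_scale)
      from ray[OF this]
      have "m * ((e \<bullet> e) + 2 * t * (z \<bullet> e) + t^2 * (z \<bullet> z)) \<le> ?q e + 2 * t * (z \<bullet> (A *v e)) + t^2 * ?q z"
        using sym[of e z]
        by (simp add: matrix_vector_right_distrib matrix_vector_mult_scaleR inner_add_left inner_add_right
            inner_commute[of e z] power2_eq_square algebra_simps)
      moreover have "e \<bullet> e = 1" using e(2) by (simp add: dot_square_norm)
      ultimately show ?thesis
        by (simp add: B_def C_def m_def[symmetric] algebra_simps)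
    qed
    have C0: "C \<ge> 0" using ray[OF z] by (simp add: C_def)
    \<comment> \<open>A quadratic in \<open>t\<close> without constant term stays nonnegative only
      if its linear coefficient \<open>B\<close> vanishes. The test value is
      \<open>t = - B / r\<close>; the added 1 avoids division by zero when
      \<open>C = 0\<close>.\<close>
    define r where "r = C + 1"
    have r: "r \<ge> 1" "C = r - 1" using C0 by (simp_all add: r_def)
    have "0 \<le> 2 * (- B / r) * B + (- B / r)^2 * C" by (rule pos)
    also have "\<dots> = - (B^2 * (r + 1)) / r^2"
      using r(1) by (simp add: r(2) field_simps power2_eq_square)
    finally have "B^2 * (C + 2) \<le> 0"
      using r(1) by (simp add: r(2) field_simps)
    then have "B^2 \<le> 0"
      using C0 by (smt (verit, best) mult_pos_pos)
    then show ?thesis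
      by (simp add: B_def inner_diff_left inner_commute[of z])
  qed
  have e_eig: "eigenpair_on T (compression T A) m e"
    unfolding eigenpair_on_def compression_def
    using e T ortho by (auto intro!: orth_proj_eqI simp: subspace_scale)
  have "m \<le> l" if "eigenpair_on T (compression T A) l v" for l v
  proof -
    have v: "v \<in> T" "v \<noteq> 0" using that by (auto simp: eigenpair_on_def)
    have "m * (v \<bullet> v) \<le> l * (v \<bullet> v)"
      using ray[OF v(1)] eigenpair_on_compression_inner[OF T that v(1)] by simp
    then show ?thesis using v(2) by simp
  qed
  then have m_eq: "min_eigenvalue_on T (compression T A) = m"
    unfolding min_eigenvalue_on_def using e_eig by (intro Least_equality) blast+
  then show ?thesis
    using ray[OF w] by simp
qed

text \<open>The hypotheses make \<open>L\<close> the inverse of the compression of \<open>H\<close> to \<open>T\<close>, precomposed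
  with the orthogonal projection onto \<open>T\<close>.\<close>

lemma onorm_solution_operator_bounds:
  fixes H :: "real^'d^'d"
  assumes L: "bounded_linear L" "\<And>z. L z \<in> T" "\<And>z w. w \<in> T \<Longrightarrow> (H *v L z) \<bullet> w = z \<bullet> w"
    and sym: "\<And>x y. x \<bullet> (H *v y) = y \<bullet> (H *v x)"
    and psd: "\<And>x. 0 \<le> x \<bullet> (H *v x)"
  shows "(\<And>w. w \<in> T \<Longrightarrow> c * (w \<bullet> w) \<le> w \<bullet> (H *v w)) \<Longrightarrow> 0 \<le> c \<Longrightarrow> c * onorm L \<le> 1"
    and "v \<in> T \<Longrightarrow> v \<noteq> 0 \<Longrightarrow> v \<bullet> (H *v v) \<le> c * (v \<bullet> v) \<Longrightarrow> 1 \<le> c * onorm L"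
proof -
  assume lower: "\<And>w. w \<in> T \<Longrightarrow> c * (w \<bullet> w) \<le> w \<bullet> (H *v w)" and c: "0 \<le> c"
  show "c * onorm L \<le> 1"
  proof (cases "c = 0")
    case False
    then have c: "c > 0" using c by simp
    have "norm (L z) \<le> (1 / c) * norm z" for z
    proof (cases "L z = 0")
      case False
      \<comment> \<open>Coercivity at \<open>L z\<close>, combined with the equation for
        \<open>L\<close> tested with \<open>L z\<close> itself.\<close>
      have "c * (L z \<bullet> L z) \<le> z \<bullet> L z"
        using lower[OF L(2), of z] L(3)[OF L(2), of z z] by (simp add: inner_commute)
      also have "\<dots> \<le> norm z * norm (L z)" by (rule norm_cauchy_schwarz)
      finally have "(c * norm (L z)) * norm (L z) \<le> norm z * norm (L z)"
        by (simp add: dot_square_norm power2_eq_square mult.assoc)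
      then show ?thesis using False c by (simp add: field_simps)
    qed (use c in simp)
    then have "onorm L \<le> 1 / c" by (intro onorm_bound) (use c in auto)
    then show ?thesis using c by (simp add: field_simps)
  qed simp
next
  assume v: "v \<in> T" "v \<noteq> 0" and upper: "v \<bullet> (H *v v) \<le> c * (v \<bullet> v)"
  define a where "a = v \<bullet> L v"
  define r where "r = v \<bullet> (H *v v)"
  have Hv: "v \<bullet> (H *v L v) = v \<bullet> v" "L v \<bullet> (H *v L v) = a"
    using L(3)[OF v(1), of v] L(3)[OF L(2), of v v] by (simp_all add: inner_commute a_def)
  \<comment> \<open>Nonnegativity of the form at \<open>L v - t *\<^sub>R v\<close> is
    Cauchy-Schwarz for a possibly degenerate form; it will give
    \<open>(v \<bullet> v) * (v \<bullet> v) \<le> a * r\<close> at the minimizing value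
    \<open>t = (v \<bullet> v) / r\<close>.\<close>
  have pos: "0 \<le> a - 2 * t * (v \<bullet> v) + t^2 * r" for t
  proof -
    have "0 \<le> (L v - t *\<^sub>R v) \<bullet> (H *v (L v - t *\<^sub>R v))" by (rule psd)
    also have "\<dots> = a - 2 * t * (v \<bullet> v) + t^2 * r"
      using Hv sym[of "L v" v]
      by (simp add: matrix_vector_mult_diff_distrib matrix_vector_mult_scaleR inner_diff_left
          inner_diff_right r_def power2_eq_square algebra_simps)
    finally show ?thesis .
  qed
  have vv: "v \<bullet> v > 0" using v(2) by simp
  \<comment> \<open>If \<open>r\<close> were 0, the chosen \<open>t\<close> would make the
    nonnegative expression equal to -1.\<close>
  have "r \<noteq> 0"
    using pos[of "(a + 1) / (2 * (v \<bullet> v))"] vv by auto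
  then have r: "r > 0" using psd[of v] by (simp add: r_def)
  have "0 \<le> a - 2 * ((v \<bullet> v) / r) * (v \<bullet> v) + ((v \<bullet> v) / r)^2 * r" by (rule pos)
  also have "\<dots> = a - (v \<bullet> v) * (v \<bullet> v) / r"
    using r by (simp add: field_simps power2_eq_square)
  finally have "(v \<bullet> v) * (v \<bullet> v) \<le> a * r"
    using r by (simp add: field_simps)
  also have "\<dots> \<le> (onorm L * (v \<bullet> v)) * r"
  proof (rule mult_right_mono)
    have "a \<le> norm v * norm (L v)" unfolding a_def by (rule norm_cauchy_schwarz)
    also have "\<dots> \<le> norm v * (onorm L * norm v)"
      by (intro mult_left_mono onorm L) simp
    finally show "a \<le> onorm L * (v \<bullet> v)"
      by (simp add: dot_square_norm power2_eq_square mult_ac)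
  qed (use r in simp)
  also have "\<dots> \<le> (onorm L * (v \<bullet> v)) * (c * (v \<bullet> v))"
    using upper onorm_pos_le[OF L(1)] vv by (intro mult_left_mono) (auto simp: r_def)
  finally have "1 * ((v \<bullet> v) * (v \<bullet> v)) \<le> (c * onorm L) * ((v \<bullet> v) * (v \<bullet> v))"
    by (simp add: mult_ac)
  then show "1 \<le> c * onorm L"
    using vv by (simp add: mult_le_cancel_right)
qed

section \<open>Joint laws, second moments and Wasserstein bounds\<close>

lemma sets_joint_law:
  assumes K: "K \<in> borel \<rightarrow>\<^sub>M prob_algebra borel" and \<mu>: "sets \<mu> = sets (borel :: 'a::euclidean_space measure)"
  shows "sets (joint_law \<mu> K) = sets (borel \<Otimes>\<^sub>M borel)"
proof -
  have "space \<mu> \<noteq> {}" using sets_eq_imp_space_eq[OF \<mu>] by simp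
  moreover have "space (K x) \<noteq> {}" for x
    using measurable_space[OF K, of x] by (auto simp: space_prob_algebra prob_space.not_empty)
  ultimately show ?thesis
    unfolding joint_law_def by (intro sets_bind) auto
qed

lemma joint_law_kernel:
  fixes K :: "'a::euclidean_space \<Rightarrow> real measure"
  assumes K: "K \<in> borel \<rightarrow>\<^sub>M prob_algebra borel"
  shows "(\<lambda>x. K x \<bind> (\<lambda>y. return (borel \<Otimes>\<^sub>M borel) (x, y))) \<in> borel \<rightarrow>\<^sub>M subprob_algebra (borel \<Otimes>\<^sub>M borel)"
  by (rule measurable_bind[OF measurable_prob_algebraD[OF K]])
    (rule measurable_compose[OF _ return_measurable], simp)

lemma nn_integral_joint_law:
  fixes K :: "'a::euclidean_space \<Rightarrow> real measure"
  assumes K: "K \<in> borel \<rightarrow>\<^sub>M prob_algebra borel" and \<mu>: "sets \<mu> = sets borel"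
    and f: "f \<in> borel_measurable (borel \<Otimes>\<^sub>M borel)"
  shows "(\<integral>\<^sup>+z. f z \<partial>joint_law \<mu> K) = (\<integral>\<^sup>+x. \<integral>\<^sup>+y. f (x, y) \<partial>K x \<partial>\<mu>)"
proof -
  let ?B = "borel \<Otimes>\<^sub>M borel :: ('a \<times> real) measure"
  have "(\<integral>\<^sup>+z. f z \<partial>joint_law \<mu> K) =
      (\<integral>\<^sup>+x. \<integral>\<^sup>+z. f z \<partial>(K x \<bind> (\<lambda>y. return ?B (x, y))) \<partial>\<mu>)"
    unfolding joint_law_def
    by (rule nn_integral_bind[OF f])
      (use joint_law_kernel[OF K] \<mu> in \<open>simp cong: measurable_cong_sets\<close>)
  also have "\<dots> = (\<integral>\<^sup>+x. \<integral>\<^sup>+y. f (x, y) \<partial>K x \<partial>\<mu>)"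
  proof (rule nn_integral_cong)
    fix x :: 'a
    have Kx: "sets (K x) = sets borel"
      using measurable_space[OF K, of x] by (simp add: space_prob_algebra)
    have "(\<integral>\<^sup>+z. f z \<partial>(K x \<bind> (\<lambda>y. return ?B (x, y)))) =
        (\<integral>\<^sup>+y. \<integral>\<^sup>+z. f z \<partial>return ?B (x, y) \<partial>K x)"
      by (rule nn_integral_bind[OF f])
        (use Kx in \<open>auto intro!: measurable_compose[OF _ return_measurable] cong: measurable_cong_sets\<close>)
    also have "\<dots> = (\<integral>\<^sup>+y. f (x, y) \<partial>K x)"
      by (intro nn_integral_cong nn_integral_return f) (simp add: space_pair_measure)
    finally show "(\<integral>\<^sup>+z. f z \<partial>(K x \<bind> (\<lambda>y. return ?B (x, y)))) = (\<integral>\<^sup>+y. f (x, y) \<partial>K x)" .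
  qed
  finally show ?thesis .
qed

text \<open>Fubini for the kernel, reduced to the nonnegative version by splitting \<open>f\<close>
  into positive and negative parts with fibre integrals \<open>p\<close> and \<open>n\<close>, both
  finite almost everywhere.\<close>

lemma integral_joint_law:
  fixes K :: "'a::euclidean_space \<Rightarrow> real measure" and f :: "'a \<times> real \<Rightarrow> real"
  assumes K: "K \<in> borel \<rightarrow>\<^sub>M prob_algebra borel" and \<mu>: "sets \<mu> = sets borel"
    and int: "integrable (joint_law \<mu> K) f"
  shows AE_integrable_joint_law: "AE x in \<mu>. integrable (K x) (\<lambda>y. f (x, y))"
    and borel_measurable_integral_kernel: "(\<lambda>x. \<integral>y. f (x, y) \<partial>K x) \<in> borel_measurable \<mu>"
    and "(\<integral>z. f z \<partial>joint_law \<mu> K) = (\<integral>x. (\<integral>y. f (x, y) \<partial>K x) \<partial>\<mu>)"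
proof -
  have f[measurable]: "f \<in> borel_measurable (borel \<Otimes>\<^sub>M borel)"
    using borel_measurable_integrable[OF int] sets_joint_law[OF K \<mu>]
    by (simp cong: measurable_cong_sets)
  define p where "p = (\<lambda>x. \<integral>\<^sup>+y. ennreal (f (x, y)) \<partial>K x)"
  define n where "n = (\<lambda>x. \<integral>\<^sup>+y. ennreal (- f (x, y)) \<partial>K x)"
  have K': "K \<in> borel \<rightarrow>\<^sub>M subprob_algebra borel" by (rule measurable_prob_algebraD[OF K])
  have "p \<in> borel_measurable borel" "n \<in> borel_measurable borel"
    unfolding p_def n_def
    by (rule nn_integral_measurable_subprob_algebra2[OF _ K'], simp)+
  then have [measurable]: "p \<in> borel_measurable \<mu>" "n \<in> borel_measurable \<mu>"
    using \<mu> by (simp_all cong: measurable_cong_sets)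
  have P: "(\<integral>\<^sup>+z. ennreal (f z) \<partial>joint_law \<mu> K) = (\<integral>\<^sup>+x. p x \<partial>\<mu>)"
    and N: "(\<integral>\<^sup>+z. ennreal (- f z) \<partial>joint_law \<mu> K) = (\<integral>\<^sup>+x. n x \<partial>\<mu>)"
    unfolding p_def n_def by (rule nn_integral_joint_law[OF K \<mu>], simp)+
  have fin: "(\<integral>\<^sup>+x. p x \<partial>\<mu>) \<noteq> \<infinity>" "(\<integral>\<^sup>+x. n x \<partial>\<mu>) \<noteq> \<infinity>"
    using int unfolding real_integrable_def P N by auto
  have AEp: "AE x in \<mu>. p x \<noteq> \<infinity>" and AEn: "AE x in \<mu>. n x \<noteq> \<infinity>"
    by (rule nn_integral_PInf_AE; use fin in simp)+
  have meas: "(\<lambda>y. f (x, y)) \<in> borel_measurable (K x)" for x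
  proof -
    have "sets (K x) = sets borel"
      using measurable_space[OF K, of x] by (simp add: space_prob_algebra)
    then show ?thesis by (simp cong: measurable_cong_sets)
  qed
  show ae: "AE x in \<mu>. integrable (K x) (\<lambda>y. f (x, y))"
    using AEp AEn
    by eventually_elim (use meas in \<open>auto simp: real_integrable_def p_def n_def\<close>)
  have enn: "integrable \<mu> (\<lambda>x. enn2real (q x))"
      "(\<integral>x. enn2real (q x) \<partial>\<mu>) = enn2real (\<integral>\<^sup>+x. q x \<partial>\<mu>)"
    if [measurable]: "q \<in> borel_measurable \<mu>" and q: "(\<integral>\<^sup>+x. q x \<partial>\<mu>) \<noteq> \<infinity>"
      and AEq: "AE x in \<mu>. q x \<noteq> \<infinity>" for q
  proof -
    have eq: "(\<integral>\<^sup>+x. ennreal (enn2real (q x)) \<partial>\<mu>) = (\<integral>\<^sup>+x. q x \<partial>\<mu>)"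
      by (rule nn_integral_cong_AE) (use AEq in \<open>auto elim!: eventually_mono simp: top.not_eq_extremum\<close>)
    show "integrable \<mu> (\<lambda>x. enn2real (q x))"
      using q by (intro integrableI_nonneg) (auto simp: eq top.not_eq_extremum)
    show "(\<integral>x. enn2real (q x) \<partial>\<mu>) = enn2real (\<integral>\<^sup>+x. q x \<partial>\<mu>)"
      by (subst integral_eq_nn_integral) (auto simp: eq)
  qed
  \<comment> \<open>On fibres where \<open>f\<close> is not integrable the integral is 0 by
    convention. The formula holds at every \<open>x\<close>, so the inner integral is measurable
    without an exceptional set.\<close>
  have "(\<integral>y. f (x, y) \<partial>K x) = (if p x = \<top> \<or> n x = \<top> then 0 else enn2real (p x) - enn2real (n x))" for x
  proof (cases "p x = \<top> \<or> n x = \<top>")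
    case True
    then have "\<not> integrable (K x) (\<lambda>y. f (x, y))" by (auto simp: real_integrable_def p_def n_def)
    then show ?thesis using True by (simp add: not_integrable_integral_eq)
  next
    case False
    then have "integrable (K x) (\<lambda>y. f (x, y))"
      using meas by (simp add: real_integrable_def p_def n_def)
    then show ?thesis using False by (simp add: real_lebesgue_integral_def p_def n_def)
  qed
  then show inner: "(\<lambda>x. \<integral>y. f (x, y) \<partial>K x) \<in> borel_measurable \<mu>" by simp
  have "(\<integral>x. (\<integral>y. f (x, y) \<partial>K x) \<partial>\<mu>) = (\<integral>x. enn2real (p x) - enn2real (n x) \<partial>\<mu>)"
  proof (rule integral_cong_AE[OF inner])
    show "AE x in \<mu>. (\<integral>y. f (x, y) \<partial>K x) = enn2real (p x) - enn2real (n x)"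
      using ae by eventually_elim (simp add: real_lebesgue_integral_def p_def n_def)
  qed simp
  also have "\<dots> = enn2real (\<integral>\<^sup>+x. p x \<partial>\<mu>) - enn2real (\<integral>\<^sup>+x. n x \<partial>\<mu>)"
    using enn fin AEp AEn by simp
  also have "\<dots> = (\<integral>z. f z \<partial>joint_law \<mu> K)"
    using real_lebesgue_integral_def[OF int] P N by simp
  finally show "(\<integral>z. f z \<partial>joint_law \<mu> K) = (\<integral>x. (\<integral>y. f (x, y) \<partial>K x) \<partial>\<mu>)" by simp
qed

section \<open>Second moments as quadratic forms\<close>

lemma norm_outer: "norm (outer x) = (norm x)\<^sup>2"
proof -
  have "outer x = (\<chi> i. (x $ i) *\<^sub>R x)"
    by (simp add: outer_def vec_eq_iff)
  then have "norm (outer x) = L2_set (\<lambda>i. norm x * norm (x $ i)) UNIV"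
    by (simp add: norm_vec_def[of "\<chi> i. (x $ i) *\<^sub>R x"] mult.commute)
  also have "\<dots> = norm x * L2_set (\<lambda>i. norm (x $ i)) UNIV"
    by (simp add: L2_set_right_distrib)
  finally show ?thesis
    by (simp add: norm_vec_def[of x] power2_eq_square)
qed

lemma outer_matrix_vector_mult: "outer x *v w = (x \<bullet> w) *\<^sub>R x"
  by (simp add: vec_eq_iff matrix_vector_mult_def outer_def inner_vec_def sum_distrib_left mult_ac)

text \<open>\<open>A \<mapsto> u \<bullet> (A *v w)\<close> is bounded linear and so commutes with
  the integral. The weight \<open>c\<close> lets one statement serve both the Hessian and the second
  moment.\<close>

lemma integral_outer_quadratic:
  fixes c :: "real^'d \<Rightarrow> real"
  assumes "integrable \<mu> (\<lambda>x. c x *\<^sub>R outer x)"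
  shows integrable_outer_quadratic: "integrable \<mu> (\<lambda>x. c x * ((x \<bullet> u) * (x \<bullet> w)))"
    and "u \<bullet> ((\<integral>x. c x *\<^sub>R outer x \<partial>\<mu>) *v w) = (\<integral>x. c x * ((x \<bullet> u) * (x \<bullet> w)) \<partial>\<mu>)"
proof -
  have "linear (\<lambda>A::real^'d^'d. u \<bullet> (A *v w))"
    by (rule linearI)
      (simp_all add: matrix_vector_mult_add_rdistrib inner_add_right scaleR_matrix_vector_assoc[symmetric])
  then have bl: "bounded_linear (\<lambda>A::real^'d^'d. u \<bullet> (A *v w))"
    by (rule linear_conv_bounded_linear[THEN iffD1])
  have eq: "u \<bullet> ((c x *\<^sub>R outer x) *v w) = c x * ((x \<bullet> u) * (x \<bullet> w))" for x
    by (simp add: scaleR_matrix_vector_assoc[symmetric] outer_matrix_vector_mult inner_commute mult_ac)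
  show "integrable \<mu> (\<lambda>x. c x * ((x \<bullet> u) * (x \<bullet> w)))"
    using integrable_bounded_linear[OF bl assms] by (simp add: eq)
  show "u \<bullet> ((\<integral>x. c x *\<^sub>R outer x \<partial>\<mu>) *v w) = (\<integral>x. c x * ((x \<bullet> u) * (x \<bullet> w)) \<partial>\<mu>)"
    using integral_bounded_linear[OF bl assms] by (simp add: eq)
qed

section \<open>Laws with finite second moment and transport bounds\<close>

lemma P2_D:
  assumes "\<mu> \<in> P2"
  shows "prob_space \<mu>" "sets \<mu> = sets borel" "integrable \<mu> (\<lambda>x. (norm x)\<^sup>2)"
  using assms by (simp_all add: P2_def)

lemma integrable_outer:
  assumes "\<mu> \<in> P2"
  shows "integrable \<mu> outer"
proof (rule Bochner_Integration.integrable_bound[OF P2_D(3)[OF assms]])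
  have "continuous_on UNIV (outer :: real^'d \<Rightarrow> _)"
    unfolding outer_def by (intro continuous_intros)
  then have "outer \<in> borel_measurable (borel :: (real^'d) measure)"
    by (rule borel_measurable_continuous_onI)
  then show "outer \<in> borel_measurable \<mu>"
    using P2_D(2)[OF assms] by (simp cong: measurable_cong_sets)
qed (simp add: norm_outer)

lemma second_moment_quadratic:
  assumes "\<mu> \<in> P2"
  shows integrable_second_moment: "integrable \<mu> (\<lambda>x. (x \<bullet> u) * (x \<bullet> w))"
    and "u \<bullet> (second_moment \<mu> *v w) = (\<integral>x. (x \<bullet> u) * (x \<bullet> w) \<partial>\<mu>)"
  using integral_outer_quadratic[of \<mu> "\<lambda>_. 1" u w] integrable_outer[OF assms]
  by (simp_all add: second_moment_def)

text \<open>In any coupling the second point is almost surely orthogonal to \<open>w\<close>, so the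
  component of the first along \<open>w\<close> has to be moved in full; Cauchy-Schwarz compares it
  with the whole displacement.\<close>

lemma W2_ge:
  assumes \<mu>: "\<mu> \<in> P2" and \<nu>: "\<nu> \<in> P2" and null: "AE x in \<nu>. x \<bullet> w = 0" and w: "w \<noteq> 0"
    and m: "m * (w \<bullet> w) \<le> (\<integral>x. (x \<bullet> w)\<^sup>2 \<partial>\<mu>)"
  shows "ennreal (sqrt m) \<le> W2 \<mu> \<nu>"
  unfolding W2_def
proof (rule INF_greatest)
  fix \<pi> assume "\<pi> \<in> couplings \<mu> \<nu>"
  then have sets: "sets \<pi> = sets (borel \<Otimes>\<^sub>M borel)"
    and marg: "distr \<pi> borel fst = \<mu>" "distr \<pi> borel snd = \<nu>"
    by (simp_all add: couplings_def)
  have [measurable]: "fst \<in> \<pi> \<rightarrow>\<^sub>M borel" "snd \<in> \<pi> \<rightarrow>\<^sub>M borel"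
    by (simp_all cong: measurable_cong_sets add: sets)
  have int: "integrable \<pi> (\<lambda>z. (norm (fst z))\<^sup>2)" "integrable \<pi> (\<lambda>z. (norm (snd z))\<^sup>2)"
    using P2_D(3)[OF \<mu>] P2_D(3)[OF \<nu>]
    by (simp_all add: marg[symmetric] integrable_distr_eq)
  have AE0: "AE z in \<pi>. snd z \<bullet> w = 0"
    using null unfolding marg(2)[symmetric] by (simp add: AE_distr_iff)
  \<comment> \<open>A nonintegrable cost would have integral 0 and break the lower bound.
    Integrability follows from the parallelogram law.\<close>
  have cost: "integrable \<pi> (\<lambda>z. (norm (fst z - snd z))\<^sup>2)"
  proof (rule Bochner_Integration.integrable_bound)
    show "integrable \<pi> (\<lambda>z. 2 * (norm (fst z))\<^sup>2 + 2 * (norm (snd z))\<^sup>2)"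
      using int by simp
    have "(norm (x - y))\<^sup>2 \<le> 2 * (norm x)\<^sup>2 + 2 * (norm y)\<^sup>2" for x y :: 'a
    proof -
      have "(norm (x - y))\<^sup>2 + (norm (x + y))\<^sup>2 = 2 * (norm x)\<^sup>2 + 2 * (norm y)\<^sup>2"
        by (simp add: power2_norm_eq_inner inner_add_left inner_add_right inner_diff_left
            inner_diff_right inner_commute)
      then show ?thesis by (smt (verit) zero_le_power2)
    qed
    then show "AE z in \<pi>. norm ((norm (fst z - snd z))\<^sup>2) \<le> norm (2 * (norm (fst z))\<^sup>2 + 2 * (norm (snd z))\<^sup>2)"
      by (intro AE_I2) (simp add: abs_of_nonneg)
  qed simp
  have "m * (w \<bullet> w) \<le> (\<integral>z. (fst z \<bullet> w)\<^sup>2 \<partial>\<pi>)"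
    using m unfolding marg(1)[symmetric] by (simp add: integral_distr)
  also have "\<dots> \<le> (\<integral>z. (w \<bullet> w) * (norm (fst z - snd z))\<^sup>2 \<partial>\<pi>)"
  proof (rule integral_mono_AE')
    show "integrable \<pi> (\<lambda>z. (w \<bullet> w) * (norm (fst z - snd z))\<^sup>2)"
      using cost by simp
    show "AE z in \<pi>. (fst z \<bullet> w)\<^sup>2 \<le> (w \<bullet> w) * (norm (fst z - snd z))\<^sup>2"
      using AE0
    proof eventually_elim
      case (elim z)
      then have "(fst z \<bullet> w)\<^sup>2 = ((fst z - snd z) \<bullet> w)\<^sup>2" by (simp add: inner_diff_left)
      also have "\<dots> \<le> ((fst z - snd z) \<bullet> (fst z - snd z)) * (w \<bullet> w)"
        by (rule Cauchy_Schwarz_ineq)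
      finally show ?case by (simp add: power2_norm_eq_inner mult.commute)
    qed
  qed simp
  finally have "m * (w \<bullet> w) \<le> (w \<bullet> w) * (\<integral>z. (norm (fst z - snd z))\<^sup>2 \<partial>\<pi>)" by simp
  then have "m \<le> (\<integral>z. (norm (fst z - snd z))\<^sup>2 \<partial>\<pi>)"
    using w by (simp add: mult.commute)
  then show "ennreal (sqrt m) \<le> ennreal (sqrt (\<integral>(x, y). (norm (x - y))\<^sup>2 \<partial>\<pi>))"
    by (intro ennreal_leI real_sqrt_le_mono) (simp add: case_prod_unfold)
qed

text \<open>Moving each point along the map \<open>p\<close> is itself a coupling, namely the image
  of \<open>\<mu>\<close> under \<open>x \<mapsto> (x, p x)\<close>.\<close>

lemma W2_distr_le:
  assumes \<mu>: "\<mu> \<in> P2" and p[measurable]: "p \<in> borel \<rightarrow>\<^sub>M borel"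
  shows "W2 \<mu> (distr \<mu> borel p) \<le> ennreal (sqrt (\<integral>x. (norm (x - p x))\<^sup>2 \<partial>\<mu>))"
proof -
  interpret prob_space \<mu> by (rule P2_D(1)[OF \<mu>])
  have [measurable_cong]: "sets \<mu> = sets borel" by (rule P2_D(2)[OF \<mu>])
  let ?\<pi> = "distr \<mu> (borel \<Otimes>\<^sub>M borel) (\<lambda>x. (x, p x))"
  have "distr \<mu> borel (\<lambda>x. x) = \<mu>"
    using distr_id2[of borel \<mu>] P2_D(2)[OF \<mu>] by simp
  then have "?\<pi> \<in> couplings \<mu> (distr \<mu> borel p)"
    by (auto simp: couplings_def distr_distr comp_def prob_space_distr)
  moreover have "(\<integral>(x, y). (norm (x - y))\<^sup>2 \<partial>?\<pi>) = (\<integral>x. (norm (x - p x))\<^sup>2 \<partial>\<mu>)"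
    by (subst integral_distr) (simp_all add: case_prod_beta)
  ultimately show ?thesis
    unfolding W2_def by (metis (mono_tags, lifting) INF_lower)
qed

section \<open>Generalized linear models\<close>

text \<open>One feature law at a time: the given law is interpreted once, while each competitor in
  \<open>Q\<close> uses the stability criterion of its own instance.\<close>

locale glm_features =
  fixes M :: "(real^'d) set" and b :: "real^'d" and k :: nat
    and h h' h'' :: "real \<Rightarrow> real" and \<sigma> :: real
    and K :: "real^'d \<Rightarrow> real measure" and \<mu> :: "(real^'d) measure"
  assumes manifold: "C2_submanifold k M" and b_M: "b \<in> M"
    and h': "\<And>t. (h has_real_derivative h' t) (at t)"
    and h_convex: "convex_on UNIV h"
    and h''_pos: "\<And>t. h'' t > 0"
    and K: "K \<in> borel \<rightarrow>\<^sub>M prob_algebra borel"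
    and \<mu>: "\<mu> \<in> P2"
    and glm: "glm_conditions h' h'' \<sigma> b K \<mu>"
    and regular: "regular_feature_law M h h' h'' b K \<mu>"
begin

abbreviation "f \<equiv> qmle_objective h K \<mu>"
abbreviation "T \<equiv> tangent_space M b"
abbreviation "mineig \<equiv> min_eigenvalue_on T (compression T (second_moment \<mu>))"

definition "G\<^sub>0 = (\<integral>x. h' (x \<bullet> b) *\<^sub>R x \<partial>\<mu>)"
definition "Hess = (\<integral>x. h'' (x \<bullet> b) *\<^sub>R outer x \<partial>\<mu>)"

lemma
  shows integrable_h: "\<beta> \<in> M \<Longrightarrow> integrable \<mu> (\<lambda>x. h (x \<bullet> \<beta>))"
    and integrable_loss: "\<beta> \<in> M \<Longrightarrow> integrable (joint_law \<mu> K) (\<lambda>(x, y). h (x \<bullet> \<beta>) - y * (x \<bullet> \<beta>))"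
    and integrable_gradient: "integrable \<mu> (\<lambda>x. h' (x \<bullet> b) *\<^sub>R x)"
    and integrable_Hessian: "integrable \<mu> (\<lambda>x. h'' (x \<bullet> b) *\<^sub>R outer x)"
    and Hessian_ext: "has_gradient_hessian_ext M (\<lambda>\<beta>. \<integral>x. h (x \<bullet> \<beta>) \<partial>\<mu>) b G\<^sub>0 Hess"
  using regular by (simp_all add: regular_feature_law_def G\<^sub>0_def Hess_def)

lemma gradient_inner:
  shows integrable_gradient_inner: "integrable \<mu> (\<lambda>x. h' (x \<bullet> b) * (x \<bullet> \<beta>))"
    and "G\<^sub>0 \<bullet> \<beta> = (\<integral>x. h' (x \<bullet> b) * (x \<bullet> \<beta>) \<partial>\<mu>)"
  using integrable_inner_left[OF integrable_gradient, of \<beta>]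
    integral_inner_left[OF integrable_gradient, of \<beta>]
  by (simp_all add: G\<^sub>0_def)

text \<open>Fubini replaces the label by its conditional mean \<open>h' (x \<bullet> b)\<close>,
  which leaves a linear term whose coefficient is the gradient of the first term at
  \<open>b\<close>. This is the shape that \<open>tilted_chart_exists\<close> expects.\<close>

lemma objective_eq:
  assumes "\<beta> \<in> M"
  shows "f \<beta> = (\<integral>x. h (x \<bullet> \<beta>) \<partial>\<mu>) - G\<^sub>0 \<bullet> \<beta>"
proof -
  have sets: "sets \<mu> = sets borel" by (rule P2_D(2)[OF \<mu>])
  note int = integrable_loss[OF assms]
  have "AE x in \<mu>. (\<integral>y. h (x \<bullet> \<beta>) - y * (x \<bullet> \<beta>) \<partial>K x) = h (x \<bullet> \<beta>) - h' (x \<bullet> b) * (x \<bullet> \<beta>)"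
    using AE_integrable_joint_law[OF K sets int] glm[unfolded glm_conditions_def]
  proof eventually_elim
    case (elim x)
    interpret prob_space "K x"
      using measurable_space[OF K, of x] by (simp add: space_prob_algebra)
    show ?case
    \<comment> \<open>For nonzero \<open>x \<bullet> \<beta>\<close>, integrability of
      \<open>y\<close> is recovered by solving the loss for \<open>y\<close>; otherwise the label
      term is zero whatever \<open>y\<close> is.\<close>
    proof (cases "x \<bullet> \<beta> = 0")
      case False
      have 1: "integrable (K x) (\<lambda>y. h (x \<bullet> \<beta>) - y * (x \<bullet> \<beta>))"
        using elim(1) by simp
      have "integrable (K x) (\<lambda>y. (h (x \<bullet> \<beta>) - (h (x \<bullet> \<beta>) - y * (x \<bullet> \<beta>))) / (x \<bullet> \<beta>))"
        by (intro integrable_divide Bochner_Integration.integrable_diff 1 integrable_const)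
      then have "integrable (K x) (\<lambda>y. y)" using False by simp
      then show ?thesis using elim(2) by (simp add: prob_space)
    qed (simp add: prob_space)
  qed
  then have "AE x in \<mu>. (\<integral>y. (\<lambda>(x, y). h (x \<bullet> \<beta>) - y * (x \<bullet> \<beta>)) (x, y) \<partial>K x) =
      h (x \<bullet> \<beta>) - h' (x \<bullet> b) * (x \<bullet> \<beta>)" by simp
  moreover have "(\<lambda>x. h (x \<bullet> \<beta>) - h' (x \<bullet> b) * (x \<bullet> \<beta>)) \<in> borel_measurable \<mu>"
    by (intro borel_measurable_integrable Bochner_Integration.integrable_diff integrable_h assms
        integrable_gradient_inner)
  ultimately have "f \<beta> = (\<integral>x. h (x \<bullet> \<beta>) - h' (x \<bullet> b) * (x \<bullet> \<beta>) \<partial>\<mu>)"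
    unfolding qmle_objective_def integral_joint_law(3)[OF K sets int]
    by (intro integral_cong_AE borel_measurable_integral_kernel[OF K sets int])
  then show ?thesis
    using integrable_h[OF assms] gradient_inner by simp
qed

text \<open>The tangent line inequality of \<open>h\<close> at \<open>x \<bullet> b\<close> holds
  pointwise and is integrated. The geometry of \<open>M\<close> does not enter, so the minimum is
  global.\<close>

lemma is_minimizer_b: "is_minimizer M f b"
  unfolding is_minimizer_def
proof (intro conjI ballI b_M)
  fix \<beta> assume \<beta>: "\<beta> \<in> M"
  have "(\<integral>x. h (x \<bullet> b) - h' (x \<bullet> b) * (x \<bullet> b) \<partial>\<mu>) \<le> (\<integral>x. h (x \<bullet> \<beta>) - h' (x \<bullet> b) * (x \<bullet> \<beta>) \<partial>\<mu>)"
  proof (rule integral_mono)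
    fix x
    have "h' (x \<bullet> b) * (x \<bullet> \<beta> - x \<bullet> b) \<le> h (x \<bullet> \<beta>) - h (x \<bullet> b)"
      by (rule convex_on_imp_above_tangent[OF h_convex]) (use h' in auto)
    then show "h (x \<bullet> b) - h' (x \<bullet> b) * (x \<bullet> b) \<le> h (x \<bullet> \<beta>) - h' (x \<bullet> b) * (x \<bullet> \<beta>)"
      by (simp add: algebra_simps)
  qed (intro Bochner_Integration.integrable_diff integrable_h \<beta> b_M integrable_gradient_inner)+
  then show "f b \<le> f \<beta>"
    using objective_eq[OF \<beta>] objective_eq[OF b_M] integrable_h[OF \<beta>] integrable_h[OF b_M] gradient_inner
    by simp
qed

section \<open>Hessian form and well-posedness\<close>

lemma Hessian_inner:
  shows integrable_Hessian_inner: "integrable \<mu> (\<lambda>x. h'' (x \<bullet> b) * ((x \<bullet> u) * (x \<bullet> w)))"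
    and "u \<bullet> (Hess *v w) = (\<integral>x. h'' (x \<bullet> b) * ((x \<bullet> u) * (x \<bullet> w)) \<partial>\<mu>)"
  using integral_outer_quadratic[OF integrable_Hessian] by (simp_all add: Hess_def)

lemma Hessian_sym: "u \<bullet> (Hess *v w) = w \<bullet> (Hess *v u)"
  by (simp add: Hessian_inner mult_ac)

lemma second_moment_sym: "u \<bullet> (second_moment \<mu> *v w) = w \<bullet> (second_moment \<mu> *v u)"
  by (simp add: second_moment_quadratic[OF \<mu>] mult.commute)

lemma Hessian_nonneg: "0 \<le> u \<bullet> (Hess *v u)"
  unfolding Hessian_inner by (rule Bochner_Integration.integral_nonneg) (simp add: less_imp_le[OF h''_pos])

text \<open>The integrand is a square times the positive weight \<open>h''\<close>, so the integral
  vanishes exactly when the square does almost surely.\<close>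

lemma Hessian_eq_0_iff: "u \<bullet> (Hess *v u) = 0 \<longleftrightarrow> (AE x in \<mu>. x \<bullet> u = 0)"
proof -
  have "u \<bullet> (Hess *v u) = 0 \<longleftrightarrow> (AE x in \<mu>. h'' (x \<bullet> b) * ((x \<bullet> u) * (x \<bullet> u)) = 0)"
    unfolding Hessian_inner
    by (rule integral_nonneg_eq_0_iff_AE[OF integrable_Hessian_inner])
      (simp add: less_imp_le[OF h''_pos])
  also have "\<dots> \<longleftrightarrow> (AE x in \<mu>. x \<bullet> u = 0)"
    using h''_pos by (simp add: less_imp_neq[symmetric])
  finally show ?thesis .
qed

lemma subspace_T: "subspace T"
  by (rule subspace_tangent_space[OF manifold b_M Hessian_ext objective_eq])

lemma tilt_stable_iff:
  "tilt_stable_minimizer M f b \<longleftrightarrow> \<not> (\<exists>w\<in>T. w \<noteq> 0 \<and> (AE x in \<mu>. x \<bullet> w = 0))"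
proof
  assume stable: "tilt_stable_minimizer M f b"
  obtain L where "bounded_linear L" "REG M f b = ennreal (onorm L)" and L: "\<And>z. L z \<in> T"
    "\<And>z w. w \<in> T \<Longrightarrow> (Hess *v L z) \<bullet> w = z \<bullet> w"
    using tilt_stable_REG[OF manifold b_M Hessian_ext objective_eq stable] by metis
  show "\<not> (\<exists>w\<in>T. w \<noteq> 0 \<and> (AE x in \<mu>. x \<bullet> w = 0))"
  proof safe
    fix w assume w: "w \<in> T" "w \<noteq> 0" "AE x in \<mu>. x \<bullet> w = 0"
    \<comment> \<open>The equation for \<open>L\<close> makes this pairing equal to
      \<open>w \<bullet> w\<close>, whereas the integral formula annihilates it because
      \<open>w\<close> is a null direction of \<open>\<mu>\<close>.\<close>
    have "w \<bullet> w = w \<bullet> (Hess *v L w)"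
      using L(2)[OF w(1), of w] by (simp add: inner_commute)
    also have "\<dots> = 0"
      unfolding Hessian_inner
      by (rule integral_eq_zero_AE) (use w(3) in \<open>auto elim: eventually_mono\<close>)
    finally show False using w(2) by simp
  qed
next
  assume nondeg: "\<not> (\<exists>w\<in>T. w \<noteq> 0 \<and> (AE x in \<mu>. x \<bullet> w = 0))"
  show "tilt_stable_minimizer M f b"
  proof (rule tilt_stable_minimizerI[OF manifold b_M Hessian_ext objective_eq is_minimizer_b])
    fix w assume "w \<in> T" "w \<noteq> 0"
    then have "w \<bullet> (Hess *v w) \<noteq> 0"
      using nondeg Hessian_eq_0_iff by blast
    then show "w \<bullet> (Hess *v w) > 0"
      using Hessian_nonneg[of w] by simp
  qed
qed

section \<open>Minimal eigenvector and the projected law\<close>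

context
  fixes v assumes v: "eigenpair_on T (compression T (second_moment \<mu>)) mineig v"
begin

lemma v_T: "v \<in> T" and v_nz: "v \<noteq> 0"
  using v by (auto simp: eigenpair_on_def)

lemma min_eigenvalue_attained: "(\<integral>x. (x \<bullet> v)\<^sup>2 \<partial>\<mu>) = mineig * (v \<bullet> v)"
  using eigenpair_on_compression_inner[OF subspace_T v v_T] second_moment_quadratic[OF \<mu>, of v v]
  by (simp add: power2_eq_square)

lemma min_eigenvalue_le: "w \<in> T \<Longrightarrow> mineig * (w \<bullet> w) \<le> (\<integral>x. (x \<bullet> w)\<^sup>2 \<partial>\<mu>)"
  using min_eigenvalue_on_compression_le[OF subspace_T v_T v_nz second_moment_sym, of w]
    second_moment_quadratic[OF \<mu>, of w w] by (simp add: power2_eq_square)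

lemma min_eigenvalue_nonneg: "0 \<le> mineig"
proof -
  have "0 \<le> mineig * (v \<bullet> v)"
    unfolding min_eigenvalue_attained[symmetric] by simp
  moreover have "v \<bullet> v > 0" using v_nz by simp
  ultimately show ?thesis by (auto simp: zero_le_mult_iff)
qed

lemma W2_ill_conditioned_ge:
  assumes "\<nu> \<in> P2" "w \<in> T" "w \<noteq> 0" "AE x in \<nu>. x \<bullet> w = 0"
  shows "ennreal (sqrt mineig) \<le> W2 \<mu> \<nu>"
  by (rule W2_ge[OF \<mu> assms(1,4,3) min_eigenvalue_le[OF assms(2)]])

lemma orth_proj_v: "orth_proj (orthogonal_comp {v}) x = x - ((x \<bullet> v) / (v \<bullet> v)) *\<^sub>R v"
  by (rule orth_proj_orthogonal_comp_singleton[OF v_nz])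

lemma measurable_orth_proj_v: "orth_proj (orthogonal_comp {v}) \<in> borel \<rightarrow>\<^sub>M borel"
  by (intro borel_measurable_continuous_onI linear_continuous_on bounded_linear_orth_proj
      subspace_orthogonal_comp)

text \<open>The displacement is the component along \<open>v\<close>, and its mean square is the
  Rayleigh quotient of \<open>v\<close>, that is, the minimal eigenvalue.\<close>

lemma W2_projected_le: "W2 \<mu> (distr \<mu> borel (orth_proj (orthogonal_comp {v}))) \<le> ennreal (sqrt mineig)"
proof -
  have "(norm (x - orth_proj (orthogonal_comp {v}) x))\<^sup>2 = (x \<bullet> v)\<^sup>2 / (v \<bullet> v)" for x
    using v_nz by (simp add: orth_proj_v power_mult_distrib power2_norm_eq_inner power_divide)
      (simp add: power2_eq_square)
  then have "(\<integral>x. (norm (x - orth_proj (orthogonal_comp {v}) x))\<^sup>2 \<partial>\<mu>) = mineig"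
    using v_nz by (simp add: min_eigenvalue_attained)
  then show ?thesis
    using W2_distr_le[OF \<mu> measurable_orth_proj_v] by simp
qed

lemma AE_projected: "AE x in distr \<mu> borel (orth_proj (orthogonal_comp {v})). x \<bullet> v = 0"
proof -
  have "orth_proj (orthogonal_comp {v}) \<in> \<mu> \<rightarrow>\<^sub>M borel"
    using measurable_orth_proj_v P2_D(2)[OF \<mu>] by (simp cong: measurable_cong_sets)
  then show ?thesis
    by (subst AE_distr_iff) (use v_nz in \<open>auto simp: orth_proj_v inner_diff_left\<close>)
qed

text \<open>The Hessian form lies between the second moment form divided by \<open>cu\<close> and by
  \<open>cl\<close>. Its minimum over unit vectors of \<open>T\<close> is thus between
  \<open>mineig / cu\<close> and \<open>mineig / cl\<close>, and the norm of \<open>L\<close> is the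
  reciprocal of that minimum. The eigenvector \<open>v\<close> serves as test vector for one
  side.\<close>

lemma REG_bounds:
  assumes stable: "tilt_stable_minimizer M f b" and c: "cl > 0" "cu > 0"
    and AE_c: "AE x in \<mu>. cl \<le> inverse (h'' (x \<bullet> b)) \<and> inverse (h'' (x \<bullet> b)) \<le> cu"
  shows "ennreal cl \<le> ennreal mineig * REG M f b" "ennreal mineig * REG M f b \<le> ennreal cu"
proof -
  obtain L where L: "bounded_linear L" "REG M f b = ennreal (onorm L)" "\<And>z. L z \<in> T"
    "\<And>z w. w \<in> T \<Longrightarrow> (Hess *v L z) \<bullet> w = z \<bullet> w"
    using tilt_stable_REG[OF manifold b_M Hessian_ext objective_eq stable] by blast
  note bounds = onorm_solution_operator_bounds[OF L(1,3,4) Hessian_sym Hessian_nonneg]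
  have int2: "integrable \<mu> (\<lambda>x. (x \<bullet> w)\<^sup>2)" for w
    using integrable_second_moment[OF \<mu>, of w w] by (simp add: power2_eq_square)
  have "v \<bullet> (Hess *v v) \<le> (\<integral>x. (1 / cl) * (x \<bullet> v)\<^sup>2 \<partial>\<mu>)"
    unfolding Hessian_inner
  proof (rule integral_mono_AE[OF integrable_Hessian_inner])
    show "integrable \<mu> (\<lambda>x. (1 / cl) * (x \<bullet> v)\<^sup>2)" using int2 by simp
    show "AE x in \<mu>. h'' (x \<bullet> b) * ((x \<bullet> v) * (x \<bullet> v)) \<le> (1 / cl) * (x \<bullet> v)\<^sup>2"
      using AE_c
    proof eventually_elim
      case (elim x)
      then have "h'' (x \<bullet> b) \<le> 1 / cl"
        using c h''_pos[of "x \<bullet> b"] by (simp add: field_simps)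
      then show ?case
        unfolding power2_eq_square by (intro mult_right_mono) auto
    qed
  qed
  also have "\<dots> = mineig / cl * (v \<bullet> v)"
    by (simp add: min_eigenvalue_attained)
  finally have "1 \<le> mineig / cl * onorm L"
    using bounds(2)[OF _ v_T v_nz] by blast
  then have 1: "cl \<le> mineig * onorm L" using c by (simp add: field_simps)
  have "mineig / cu * onorm L \<le> 1"
  proof (rule bounds(1))
    show "0 \<le> mineig / cu" using c min_eigenvalue_nonneg by simp
    fix w assume w: "w \<in> T"
    have "mineig / cu * (w \<bullet> w) \<le> (\<integral>x. (1 / cu) * (x \<bullet> w)\<^sup>2 \<partial>\<mu>)"
      using min_eigenvalue_le[OF w] c by (simp add: divide_right_mono)
    also have "\<dots> \<le> w \<bullet> (Hess *v w)"
      unfolding Hessian_inner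
    proof (rule integral_mono_AE[OF _ integrable_Hessian_inner])
      show "integrable \<mu> (\<lambda>x. (1 / cu) * (x \<bullet> w)\<^sup>2)" using int2 by simp
      show "AE x in \<mu>. (1 / cu) * (x \<bullet> w)\<^sup>2 \<le> h'' (x \<bullet> b) * ((x \<bullet> w) * (x \<bullet> w))"
        using AE_c
      proof eventually_elim
        case (elim x)
        then have "1 / cu \<le> h'' (x \<bullet> b)"
          using c h''_pos[of "x \<bullet> b"] by (simp add: field_simps)
        then show ?case
          unfolding power2_eq_square by (intro mult_right_mono) auto
      qed
    qed
    finally show "mineig / cu * (w \<bullet> w) \<le> w \<bullet> (Hess *v w)" .
  qed
  then have 2: "mineig * onorm L \<le> cu" using c by (simp add: field_simps)
  have "ennreal mineig * REG M f b = ennreal (mineig * onorm L)"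
    using L(2) min_eigenvalue_nonneg by (simp add: ennreal_mult onorm_pos_le[OF L(1)])
  then show "ennreal cl \<le> ennreal mineig * REG M f b" "ennreal mineig * REG M f b \<le> ennreal cu"
    using 1 2 by (simp_all add: ennreal_leI)
qed

end

end

theorem theorem4p2:
  fixes M :: "(real^'d) set" and b :: "real^'d" and k :: nat
    and h h' h'' :: "real \<Rightarrow> real" and \<sigma> :: real
    and K :: "real^'d \<Rightarrow> real measure"
    and Q :: "(real^'d) measure set" and Dx :: "(real^'d) measure"
    and T :: "(real^'d) set"
  assumes manifold: "C2_submanifold k M" and dim: "k \<ge> 1" and b: "b \<in> M"
    and T: "T = tangent_space M b"
    and h': "\<And>t. (h has_real_derivative h' t) (at t)"
    and h'': "\<And>t. (h' has_real_derivative h'' t) (at t)"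
    and h''_cont: "continuous_on UNIV h''"
    and h_convex: "convex_on UNIV h"
    and h''_pos: "\<And>t. h'' t > 0"
    and sigma: "\<sigma>\<^sup>2 > 0"
    and K: "K \<in> borel \<rightarrow>\<^sub>M prob_algebra borel"
    and Q_P2: "Q \<subseteq> P2"
    and glm: "\<And>\<mu>. \<mu> \<in> Q \<Longrightarrow> glm_conditions h' h'' \<sigma> b K \<mu>"
    and regular: "\<And>\<mu>. \<mu> \<in> Q \<Longrightarrow> regular_feature_law M h h' h'' b K \<mu>"
    and Dx: "Dx \<in> Q"
    and proj_closed: "\<And>\<mu>. \<mu> \<in> Q \<Longrightarrow>
      \<exists>v. eigenpair_on T (compression T (second_moment \<mu>))
            (min_eigenvalue_on T (compression T (second_moment \<mu>))) v \<and>
          distr \<mu> borel (orth_proj (orthogonal_comp {v})) \<in> Q"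
  shows "RSE M h b K Q Dx =
           ennreal (sqrt (min_eigenvalue_on T (compression T (second_moment Dx)))) \<and>
         (Dx \<notin> ill_posed M h b K Q \<longrightarrow>
           (\<forall>c\<^sub>l\<^sub>b c\<^sub>u\<^sub>b :: real. c\<^sub>l\<^sub>b > 0 \<longrightarrow> c\<^sub>u\<^sub>b > 0 \<longrightarrow>
             (AE x in Dx. c\<^sub>l\<^sub>b \<le> inverse (h'' (x \<bullet> b)) \<and> inverse (h'' (x \<bullet> b)) \<le> c\<^sub>u\<^sub>b) \<longrightarrow>
             ennreal c\<^sub>l\<^sub>b \<le> (RSE M h b K Q Dx)\<^sup>2 * REG M (qmle_objective h K Dx) b \<and>
             (RSE M h b K Q Dx)\<^sup>2 * REG M (qmle_objective h K Dx) b \<le> ennreal c\<^sub>u\<^sub>b))"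
proof -
  have loc: "glm_features M b k h h' h'' \<sigma> K \<mu>" if "\<mu> \<in> Q" for \<mu>
    using that Q_P2 by unfold_locales
      (auto intro: manifold b h' h_convex h''_pos K glm regular)
  let ?m = "min_eigenvalue_on T (compression T (second_moment Dx))"
  interpret glm_features M b k h h' h'' \<sigma> K Dx by (rule loc[OF Dx])
  obtain v where v: "eigenpair_on T (compression T (second_moment Dx)) ?m v"
    and \<nu>Q: "distr Dx borel (orth_proj (orthogonal_comp {v})) \<in> Q"
    using proj_closed[OF Dx] by blast
  note v' = v[unfolded T]
  have ill_iff: "\<nu> \<in> ill_posed M h b K Q \<longleftrightarrow>
      \<nu> \<in> Q \<and> (\<exists>w\<in>tangent_space M b. w \<noteq> 0 \<and> (AE x in \<nu>. x \<bullet> w = 0))" for \<nu>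
    using glm_features.tilt_stable_iff[OF loc] by (auto simp: ill_posed_def)
  have RSE_eq: "RSE M h b K Q Dx = ennreal (sqrt ?m)"
    unfolding RSE_def W2_set_def T
  proof (rule antisym)
    \<comment> \<open>The projected law is permissible by the hypothesis on \<open>Q\<close> and
      ill-posed because \<open>v\<close> is a null direction of it, so the lower bound is
      attained.\<close>
    have "distr Dx borel (orth_proj (orthogonal_comp {v})) \<in> ill_posed M h b K Q"
      unfolding ill_iff using \<nu>Q v_T[OF v'] v_nz[OF v'] AE_projected[OF v'] by blast
    then show "(INF \<nu>\<in>ill_posed M h b K Q. W2 Dx \<nu>) \<le>
        ennreal (sqrt (min_eigenvalue_on (tangent_space M b) (compression (tangent_space M b) (second_moment Dx))))"
      using W2_projected_le[OF v'] by (rule INF_lower2)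
    show "ennreal (sqrt (min_eigenvalue_on (tangent_space M b) (compression (tangent_space M b) (second_moment Dx)))) \<le>
        (INF \<nu>\<in>ill_posed M h b K Q. W2 Dx \<nu>)"
    proof (rule INF_greatest)
      fix \<nu> assume "\<nu> \<in> ill_posed M h b K Q"
      then show "ennreal (sqrt (min_eigenvalue_on (tangent_space M b)
          (compression (tangent_space M b) (second_moment Dx)))) \<le> W2 Dx \<nu>"
        unfolding ill_iff using W2_ill_conditioned_ge[OF v'] Q_P2 by blast
    qed
  qed
  have "(RSE M h b K Q Dx)\<^sup>2 = ennreal ?m"
    using min_eigenvalue_nonneg[OF v'] by (simp add: RSE_eq T ennreal_power)
  then show ?thesis
    using RSE_eq REG_bounds[OF v'] Dx by (auto simp: ill_posed_def T)
qed

end
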